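(* Let $k\ge 2$ and let $f:\mathcal{S}^k\times\mathcal{M}^{k(k-1)/2}\to\mathbb{R}$ be a bounded measurable function such that $$\mathrm{Var}\Big[\sum_{\ell=1}^k f_{(\ell)}(X_1)\Big]>0.$$ Let $(a_n)_{n\ge 1}$ be a sequence of real numbers tending to infinity and such that $a_n\ll n^{1/(2+4k)}$. Then the sequence $\big(a_n^{-1}\overline{S}_{n,k}(f)\big)_{n\ge 1}$, where $$\overline{S}_{n,k}(f):=\frac{S_{n,k}(f)-\kappa_1(S_{n,k}(f))}{\sqrt{\kappa_2(S_{n,k}(f))}},$$ satisfies a moderate deviation principle with speed $a_n^2$ and rate function $x^2/2$.
   Context: Setting. $\mathcal{S}$ is a Borel space and $\mathcal{M}$ is a measurable space. $\{X_i\}_{i\ge1}$ are i.i.d. $\mathcal{S}$-valued random variables with common continuous (atomless) distribution $\mu$; $\{Y_{i,j}\}_{i<j}$ are i.i.d. $\mathcal{M}$-valued random variables with common distribution $\mathbb{Q}$; the two families are independent of each other, and $Y_{i,j}:=Y_{j,i}$ for $j<i$. $[n]:=\{1,\dots,n\}$ and $[n]^k_{\neq}:=\{\beta\in[n]^k:\beta(i)\neq\beta(j)\text{ for }1\le i\ne j\le k\}$. The generalized $U$-statistic is $$S_{n,k}(f):=\sum_{\beta\in[n]^k_{\neq}} f\big(X_{\beta(1)},\dots,X_{\beta(k)},Y_{\beta(1),\beta(2)},\dots,Y_{\beta(1),\beta(k)},Y_{\beta(2),\beta(3)},\dots,Y_{\beta(k-1),\beta(k)}\big),$$ where the arguments $Y_{\beta(u),\beta(v)}$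 are listed over pairs $1\le u<v\le k$ in lexicographic order. For $\ell=1,\dots,k$, $$f_{(\ell)}(x):=\int_{\mathcal{S}^{k-1}\times\mathcal{M}^{k(k-1)/2}} f(\mathbf{x},\mathbf{y})\,\mu^{\otimes(k-1)}(\mathrm{d}x_1\cdots\mathrm{d}x_{\ell-1}\mathrm{d}x_{\ell+1}\cdots\mathrm{d}x_k)\,\mathbb{Q}^{\otimes k(k-1)/2}(\mathrm{d}\mathbf{y}),$$ with $\mathbf{x}=(x_1,\dots,x_{\ell-1},x,x_{\ell+1},\dots,x_k)$. $\kappa_1,\kappa_2$ denote mean and variance. $f(n)\ll g(n)$ means $f(n)\ge0$, $g(n)>0$ and $\lim_{n\to\infty}f(n)/g(n)=0$ (for $n$ large). A sequence $(Z_n)$ of real random variables satisfies a moderate deviation principle with speed $s_n\to\infty$ and rate function $I$ if for every Borel set $B\subset\mathbb{R}$, $$-\inf_{x\in B^\circ}I(x)\le\liminf_{n\to\infty}\frac{1}{s_n}\log\mathbb{P}(Z_n\in B)\le\limsup_{n\to\infty}\frac{1}{s_n}\log\mathbb{P}(Z_n\in B)\le-\inf_{x\in\overline{B}}I(x),$$ where $B^\circ$ and $\overline B$ are the interior and closure of $B$. The statement is asymptotic, so only large $n$ (for which $\overline{S}_{n,k}(f)$ is defined) matters. *)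

theory Defs
  imports "HOL-Probability.Probability"
begin

text \<open>
  A Borel space: a measurable space that is isomorphic, by a bimeasurable bijection, to a Borel
  subset of the unit interval. Only the underlying measurable space of the argument matters.
\<close>
definition is_borel_space :: "'a measure \<Rightarrow> bool" where
  "is_borel_space M \<longleftrightarrow>
     (\<exists>(B :: real set) \<phi> \<psi>. B \<in> sets borel \<and> B \<subseteq> {0..1} \<and>
        \<phi> \<in> measurable M (restrict_space borel B) \<and>
        \<psi> \<in> measurable (restrict_space borel B) M \<and>
        (\<forall>x \<in> space M. \<psi> (\<phi> x) = x) \<and> (\<forall>y \<in> B. \<phi> (\<psi> y) = y))"

definition much_less :: "(nat \<Rightarrow> real) \<Rightarrow> (nat \<Rightarrow> real) \<Rightarrow> bool" where
  "much_less f g \<longleftrightarrow>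
     (\<forall>\<^sub>F n in sequentially. 0 \<le> f n \<and> 0 < g n) \<and> (\<lambda>n. f n / g n) \<longlonglongrightarrow> 0"

text \<open>Logarithm of a probability, with the convention that the logarithm of \<open>0\<close> is \<open>-\<infinity>\<close>.\<close>
definition log_prob :: "real \<Rightarrow> ereal" where
  "log_prob p = (if p = 0 then -\<infinity> else ereal (ln p))"

text \<open>
  The infimum of the rate function is taken in the extended reals, so that it is \<open>\<infinity>\<close> on the
  empty set.
\<close>
definition moderate_deviation_principle ::
  "'w measure \<Rightarrow> (nat \<Rightarrow> 'w \<Rightarrow> real) \<Rightarrow> (nat \<Rightarrow> real) \<Rightarrow> (real \<Rightarrow> ereal) \<Rightarrow> bool" where
  "moderate_deviation_principle P Z s I \<longleftrightarrow>
     (\<forall>n. Z n \<in> borel_measurable P) \<and>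
     filterlim s at_top sequentially \<and>
     (\<forall>B \<in> sets borel.
        - (INF x \<in> interior B. I x)
          \<le> liminf (\<lambda>n. ereal (1 / s n) * log_prob (measure P {\<omega> \<in> space P. Z n \<omega> \<in> B})) \<and>
        limsup (\<lambda>n. ereal (1 / s n) * log_prob (measure P {\<omega> \<in> space P. Z n \<omega> \<in> B}))
          \<le> - (INF x \<in> closure B. I x))"

definition index_pairs :: "nat \<Rightarrow> (nat \<times> nat) set" where
  "index_pairs k = {(u, v). 1 \<le> u \<and> u < v \<and> v \<le> k}"

definition all_index_pairs :: "(nat \<times> nat) set" where
  "all_index_pairs = {(i, j). 1 \<le> i \<and> i < j}"

text \<open>
  The domain of a kernel of order \<open>k\<close>. The second component of an argument is a family indexed
  by the pairs \<open>(u, v)\<close> with \<open>u < v\<close>, which takes the place of the listing of the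
  \<open>k (k - 1) / 2\<close> arguments in lexicographic order.
\<close>
definition kernel_space ::
  "'s measure \<Rightarrow> 'm measure \<Rightarrow> nat \<Rightarrow> ((nat \<Rightarrow> 's) \<times> (nat \<times> nat \<Rightarrow> 'm)) measure" where
  "kernel_space \<mu> \<QQ> k =
     (\<Pi>\<^sub>M u\<in>{1..k}. \<mu>) \<Otimes>\<^sub>M (\<Pi>\<^sub>M p\<in>index_pairs k. \<QQ>)"

text \<open>The injective maps from \<open>[k]\<close> to \<open>[n]\<close>.\<close>
definition distinct_tuples :: "nat \<Rightarrow> nat \<Rightarrow> (nat \<Rightarrow> nat) set" where
  "distinct_tuples n k = {\<beta> \<in> {1..k} \<rightarrow>\<^sub>E {1..n}. inj_on \<beta> {1..k}}"

definition U_stat ::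
  "(nat \<Rightarrow> 'w \<Rightarrow> 's) \<Rightarrow> (nat \<Rightarrow> nat \<Rightarrow> 'w \<Rightarrow> 'm) \<Rightarrow> nat \<Rightarrow>
   ((nat \<Rightarrow> 's) \<times> (nat \<times> nat \<Rightarrow> 'm) \<Rightarrow> real) \<Rightarrow> nat \<Rightarrow> 'w \<Rightarrow> real" where
  "U_stat X Y k f n \<omega> =
     (\<Sum>\<beta>\<in>distinct_tuples n k.
        f (\<lambda>u\<in>{1..k}. X (\<beta> u) \<omega>,
           \<lambda>p\<in>index_pairs k. Y (\<beta> (fst p)) (\<beta> (snd p)) \<omega>))"

definition normalized_U_stat ::
  "'w measure \<Rightarrow> (nat \<Rightarrow> 'w \<Rightarrow> 's) \<Rightarrow> (nat \<Rightarrow> nat \<Rightarrow> 'w \<Rightarrow> 'm) \<Rightarrow> nat \<Rightarrow>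
   ((nat \<Rightarrow> 's) \<times> (nat \<times> nat \<Rightarrow> 'm) \<Rightarrow> real) \<Rightarrow> nat \<Rightarrow> 'w \<Rightarrow> real" where
  "normalized_U_stat P X Y k f n \<omega> =
     (U_stat X Y k f n \<omega> - prob_space.expectation P (U_stat X Y k f n))
       / sqrt (prob_space.variance P (U_stat X Y k f n))"

text \<open>
  The function \<open>f\<^sub>(\<^sub>l\<^sub>)\<close>: the coordinate of index \<open>l\<close> is set to \<open>x\<close> and all the other variables
  are integrated out.
\<close>
definition kernel_marginal ::
  "'s measure \<Rightarrow> 'm measure \<Rightarrow> nat \<Rightarrow>
   ((nat \<Rightarrow> 's) \<times> (nat \<times> nat \<Rightarrow> 'm) \<Rightarrow> real) \<Rightarrow> nat \<Rightarrow> 's \<Rightarrow> real" where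
  "kernel_marginal \<mu> \<QQ> k f l x =
     (\<integral>z. f ((fst z)(l := x), snd z)
        \<partial>((\<Pi>\<^sub>M u\<in>{1..k} - {l}. \<mu>) \<Otimes>\<^sub>M (\<Pi>\<^sub>M p\<in>index_pairs k. \<QQ>)))"

text \<open>
  The measures \<open>\<mu>\<close> and \<open>\<QQ>\<close> also carry the measurable spaces in which the \<open>X\<close> and the \<open>Y\<close> take
  their values. Singletons of a Borel space are measurable, so \<open>atomless\<close> says that \<open>\<mu>\<close> has no
  point masses. The families \<open>X\<close> and \<open>Y\<close> have different value types, so their mutual
  independence is stated through the sigma-algebras that they generate.
\<close>
locale generalized_U_statistic = prob_space P
  for P :: "'w measure" +
  fixes \<mu> :: "'s measure" and \<QQ> :: "'m measure"
    and X :: "nat \<Rightarrow> 'w \<Rightarrow> 's" and Y :: "nat \<Rightarrow> nat \<Rightarrow> 'w \<Rightarrow> 'm"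
  assumes borel_space: "is_borel_space \<mu>"
    and atomless: "\<And>x. x \<in> space \<mu> \<Longrightarrow> emeasure \<mu> {x} = 0"
    and X_indep: "indep_vars (\<lambda>_. \<mu>) X {1..}"
    and X_distr: "\<And>i. 1 \<le> i \<Longrightarrow> distr P \<mu> (X i) = \<mu>"
    and Y_indep: "indep_vars (\<lambda>_. \<QQ>) (\<lambda>p. Y (fst p) (snd p)) all_index_pairs"
    and Y_distr: "\<And>i j. 1 \<le> i \<Longrightarrow> i < j \<Longrightarrow> distr P \<QQ> (Y i j) = \<QQ>"
    and Y_sym: "\<And>i j. 1 \<le> i \<Longrightarrow> i < j \<Longrightarrow> Y j i = Y i j"
    and X_Y_indep: "indep_set
       {(\<lambda>\<omega>. \<lambda>i\<in>{1..}. X i \<omega>) -` A \<inter> space P | A. A \<in> sets (\<Pi>\<^sub>M i\<in>{1..}. \<mu>)}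
       {(\<lambda>\<omega>. \<lambda>p\<in>all_index_pairs. Y (fst p) (snd p) \<omega>) -` A \<inter> space P | A.
          A \<in> sets (\<Pi>\<^sub>M p\<in>all_index_pairs. \<QQ>)}"

end

theory Submission
  imports Defs
begin

text \<open>
  By the Hoeffding decomposition, the centred statistic is a multiple of a sum of i.i.d. bounded
  variables plus a remainder in which every tuple contributes a term that has mean zero
  conditionally on any one of its vertex variables. For the i.i.d. part, the rescaled logarithmic moment
  generating function converges to \<open>t\<^sup>2 / 2\<close>, and this alone gives Gaussian upper and lower
  bounds. In the moment of order \<open>N = 2 p\<close> of the remainder, a product of \<open>N\<close> terms has
  mean zero unless each tuple shares two indices with the others, so only products with at most
  \<open>N (k - 1)\<close> distinct indices count; the crude number \<open>n\<^sup>v v\<^bsup>N k\<^esup>\<close>, \<open>v = N (k - 1)\<close>, of such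
  products bounds the normalized moment by \<open>(K p\<^bsup>2k\<^esup> / n)\<^sup>p\<close>. With \<open>p\<close> of the order of \<open>a\<^sub>n\<^sup>2\<close>, Markov's
  inequality shows that the remainder is negligible at speed \<open>a\<^sub>n\<^sup>2\<close>.
\<close>

section \<open>Moderate deviations from logarithmic moment generating functions\<close>

text \<open>When \<open>a n\<close> is a power of \<open>n\<close>,
  \<open>exp (- C * (a n)\<^sup>2)\<close> lies below every power of \<open>1 / n\<close>. A moment
  of fixed order decays only polynomially, so the order must grow with \<open>n\<close> and its
  influence on the bound must stay explicit. With \<open>p\<close> of order
  \<open>(a n)\<^sup>2\<close>, the root of order \<open>2 * p\<close> of the moment bound has size
  \<open>a n ^ (2 * k) / sqrt (real n)\<close>, while the growth condition says that
  \<open>a n ^ (2 * k + 1) / sqrt (real n)\<close> vanishes. The threshold of two shared indices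
  comes from the edge variables. Tuples with one common index share only a vertex variable, and mean
  zero given that vertex is enough; tuples with two common indices also share an edge variable,
  which projections on single vertices do not reach. A shared index is counted by at least two
  tuples, so a tuple with two shared indices accounts for at most
  \<open>(k - 2) + 2 / 2 = k - 1\<close> indices. Its factor has size \<open>n ^ (k - 1)\<close>
  against the size \<open>n powr (k - 1 / 2)\<close> of the linear part, and this half power of
  \<open>n\<close> is the whole gain.\<close>

context prob_space
begin

lemma expectation_exp_pos:
  assumes "integrable M (\<lambda>\<omega>. exp (h \<omega>))"
  shows "0 < expectation (\<lambda>\<omega>. exp (h \<omega> :: real))"
  using integral_less_AE_space[of "\<lambda>_. 0" "\<lambda>\<omega>. exp (h \<omega>)"] assms
  by (simp add: emeasure_space_1)

lemma borel_measurable_of_integrable_exp: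
  assumes "integrable M (\<lambda>\<omega>. exp (1 * h \<omega> :: real))"
  shows "h \<in> borel_measurable M"
proof -
  have "(\<lambda>\<omega>. ln (exp (1 * h \<omega>))) \<in> borel_measurable M"
    using assms by (intro borel_measurable_ln borel_measurable_integrable)
  then show ?thesis by simp
qed

text \<open>Chernoff's bound with the tilt \<open>t = x\<close>, the maximizer of
  \<open>t * x - t\<^sup>2 / 2\<close>; \<open>0 \<le> x\<close> makes the tilted exponential
  increasing in \<open>L n \<omega>\<close>.\<close>

lemma gaussian_log_mgf_upper_tail:
  fixes L :: "nat \<Rightarrow> 'a \<Rightarrow> real"
  assumes s: "filterlim s at_top sequentially"
    and int: "\<And>n t. integrable M (\<lambda>\<omega>. exp (t * L n \<omega>))"
    and mgf: "\<And>t. (\<lambda>n. ln (expectation (\<lambda>\<omega>. exp (t * s n * L n \<omega>))) / s n) \<longlonglongrightarrow> t\<^sup>2 / 2"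
    and x: "0 \<le> x" and \<epsilon>: "0 < \<epsilon>"
  shows "\<forall>\<^sub>F n in sequentially. prob {\<omega> \<in> space M. x \<le> L n \<omega>} \<le> exp (- s n * (x\<^sup>2 / 2 - \<epsilon>))"
proof -
  have "\<forall>\<^sub>F n in sequentially. ln (expectation (\<lambda>\<omega>. exp (x * s n * L n \<omega>))) / s n < x\<^sup>2 / 2 + \<epsilon>"
    using order_tendstoD(2)[OF mgf, of x "x\<^sup>2 / 2 + \<epsilon>"] \<epsilon> by simp
  moreover have "\<forall>\<^sub>F n in sequentially. 0 < s n"
    using s by (simp add: filterlim_at_top_dense)
  ultimately show ?thesis
  proof eventually_elim
    case (elim n)
    let ?E = "expectation (\<lambda>\<omega>. exp (x * s n * L n \<omega>))"
    have pos: "0 < ?E"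
      by (rule expectation_exp_pos) (rule int)
    have "ln ?E < s n * (x\<^sup>2 / 2 + \<epsilon>)"
      using elim by (simp add: field_simps)
    then have E: "?E \<le> exp (s n * (x\<^sup>2 / 2 + \<epsilon>))"
      using pos by (metis exp_le_cancel_iff exp_ln less_imp_le)
    have [measurable]: "L n \<in> borel_measurable M"
      by (rule borel_measurable_of_integrable_exp[OF int])
    have "prob {\<omega> \<in> space M. x \<le> L n \<omega>} = expectation (indicator {\<omega> \<in> space M. x \<le> L n \<omega>})"
      by simp
    also have "\<dots> \<le> expectation (\<lambda>\<omega>. exp (- s n * x\<^sup>2) * exp (x * s n * L n \<omega>))"
    proof (rule integral_mono)
      show "indicator {\<omega> \<in> space M. x \<le> L n \<omega>} \<omega> \<le> exp (- s n * x\<^sup>2) * exp (x * s n * L n \<omega>)" for \<omega>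
        using elim x mult_left_mono[of x "L n \<omega>" "x * s n"]
        by (auto simp: indicator_def exp_add[symmetric] power2_eq_square algebra_simps)
    qed (auto simp: emeasure_eq_measure int intro!: integrable_real_indicator)
    also have "\<dots> = exp (- s n * x\<^sup>2) * ?E"
      by simp
    also have "\<dots> \<le> exp (- s n * x\<^sup>2) * exp (s n * (x\<^sup>2 / 2 + \<epsilon>))"
      using E by (intro mult_left_mono) auto
    also have "\<dots> = exp (- s n * (x\<^sup>2 / 2 - \<epsilon>))"
      by (simp add: exp_add[symmetric] algebra_simps)
    finally show ?case .
  qed
qed

text \<open>Under the tilt \<open>t\<close> the mass sits near \<open>t\<close>. Beyond distance
  \<open>d\<close> the integrand \<open>exp (t * s n * L n \<omega>)\<close> is dominated by a
  multiple of the one with tilt \<open>t + d\<close> or \<open>t - d\<close>, and the expectation of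
  that multiple has exponent \<open>(t\<^sup>2 - d\<^sup>2) / 2\<close>, short of the full
  \<open>t\<^sup>2 / 2\<close>. So at least half of the expectation comes from the window, where the
  integrand is at most \<open>exp (s n * (t\<^sup>2 + \<bar>t\<bar> * d))\<close>.\<close>

lemma gaussian_log_mgf_local_lower_bound:
  fixes L :: "nat \<Rightarrow> 'a \<Rightarrow> real"
  assumes s: "filterlim s at_top sequentially"
    and int: "\<And>n t. integrable M (\<lambda>\<omega>. exp (t * L n \<omega>))"
    and mgf: "\<And>t. (\<lambda>n. ln (expectation (\<lambda>\<omega>. exp (t * s n * L n \<omega>))) / s n) \<longlonglongrightarrow> t\<^sup>2 / 2"
    and \<delta>: "0 < \<delta>" and \<epsilon>: "0 < \<epsilon>"
  shows "\<forall>\<^sub>F n in sequentially.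
    exp (- s n * (t\<^sup>2 / 2 + \<epsilon>)) \<le> prob {\<omega> \<in> space M. \<bar>L n \<omega> - t\<bar> < \<delta>}"
proof -
  \<comment> \<open>The last entry keeps the cost \<open>\<eta> + \<bar>t\<bar> * d\<close> of the
    window below \<open>\<epsilon> / 2\<close>; the entry 1 gives
    \<open>d\<^sup>2 \<le> d\<close>.\<close>
  define d where "d = Min {\<delta>, 1, \<epsilon> / (4 * (\<bar>t\<bar> + 1))}"
  \<comment> \<open>Each tail loses \<open>d\<^sup>2 / 2 = 4 * \<eta>\<close> in the exponent; one
    error \<open>\<eta>\<close> in the upper and one in the lower estimate leave a gap of
    \<open>2 * \<eta>\<close>.\<close>
  define \<eta> where "\<eta> = d\<^sup>2 / 8"
  have d: "0 < d" "d \<le> \<delta>" "d \<le> 1" "d \<le> \<epsilon> / (4 * (\<bar>t\<bar> + 1))"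
    using \<delta> \<epsilon> by (auto simp: d_def)
  have \<eta>: "0 < \<eta>" "d\<^sup>2 = 8 * \<eta>"
    using d by (auto simp: \<eta>_def)
  have "d\<^sup>2 \<le> d"
    using d mult_left_mono[of d 1 d] by (simp add: power2_eq_square)
  then have "\<eta> + \<bar>t\<bar> * d \<le> d * (\<bar>t\<bar> + 1)"
    using d by (simp add: \<eta>_def algebra_simps)
  also have "\<dots> \<le> \<epsilon> / 4"
    using d(4) by (simp add: field_simps)
  finally have small: "\<eta> + \<bar>t\<bar> * d < \<epsilon> / 2"
    using \<epsilon> by simp
  have up: "\<forall>\<^sub>F n in sequentially.
      ln (expectation (\<lambda>\<omega>. exp (r * s n * L n \<omega>))) / s n < r\<^sup>2 / 2 + \<eta>" for r
    using order_tendstoD(2)[OF mgf, of r "r\<^sup>2 / 2 + \<eta>"] \<eta> by simp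
  have lo: "\<forall>\<^sub>F n in sequentially.
      t\<^sup>2 / 2 - \<eta> < ln (expectation (\<lambda>\<omega>. exp (t * s n * L n \<omega>))) / s n"
    using order_tendstoD(1)[OF mgf, of "t\<^sup>2 / 2 - \<eta>" t] \<eta> by simp
  \<comment> \<open>Beyond \<open>ln 4 / (2 * \<eta>)\<close> the two tails make up at most half of
    the tilted expectation; beyond \<open>2 * ln 2 / \<epsilon>\<close> the spare
    \<open>\<epsilon> / 2\<close> absorbs the resulting factor 2.\<close>
  have "\<forall>\<^sub>F n in sequentially. max 0 (max (ln 4 / (2 * \<eta>)) (2 * ln 2 / \<epsilon>)) < s n"
    using s by (simp only: filterlim_at_top_dense)
  with up[of "t + d"] up[of "t - d"] lo show ?thesis
  proof eventually_elim
    case (elim n)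
    have sn: "0 < s n" "ln 4 < 2 * \<eta> * s n" "2 * ln 2 < \<epsilon> * s n"
      using elim(4) \<eta> \<epsilon> by (auto simp: field_simps)
    let ?E = "\<lambda>r. expectation (\<lambda>\<omega>. exp (r * s n * L n \<omega>))"
    have pos: "0 < ?E r" for r
      by (rule expectation_exp_pos) (rule int)
    have Eup: "?E r \<le> exp (s n * (r\<^sup>2 / 2 + \<eta>))" if "ln (?E r) / s n < r\<^sup>2 / 2 + \<eta>" for r
    proof -
      have "ln (?E r) < s n * (r\<^sup>2 / 2 + \<eta>)"
        using that sn by (simp add: field_simps)
      then show ?thesis
        using pos by (metis exp_le_cancel_iff exp_ln less_imp_le)
    qed
    have Elo: "exp (s n * (t\<^sup>2 / 2 - \<eta>)) \<le> ?E t"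
    proof -
      have "s n * (t\<^sup>2 / 2 - \<eta>) < ln (?E t)"
        using elim sn by (simp add: field_simps)
      then show ?thesis
        using pos by (metis exp_le_cancel_iff exp_ln less_imp_le)
    qed
    have [measurable]: "L n \<in> borel_measurable M"
      by (rule borel_measurable_of_integrable_exp[OF int])
    let ?A = "{\<omega> \<in> space M. \<bar>L n \<omega> - t\<bar> < d}"
    let ?c = "exp (s n * (t\<^sup>2 + \<bar>t\<bar> * d))"
    let ?p = "exp (- s n * d * (t + d))" and ?m = "exp (s n * d * (t - d))"
    have "?E t \<le> expectation (\<lambda>\<omega>. ?c * indicator ?A \<omega> + ?p * exp ((t + d) * s n * L n \<omega>)
        + ?m * exp ((t - d) * s n * L n \<omega>))"
    proof (rule integral_mono)
      fix \<omega> assume \<omega>: "\<omega> \<in> space M"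
      consider "\<bar>L n \<omega> - t\<bar> < d" | "t + d \<le> L n \<omega>" | "L n \<omega> \<le> t - d" by linarith
      then show "exp (t * s n * L n \<omega>) \<le> ?c * indicator ?A \<omega> + ?p * exp ((t + d) * s n * L n \<omega>)
        + ?m * exp ((t - d) * s n * L n \<omega>)"
      proof cases
        case 1
        have "t * L n \<omega> = t\<^sup>2 + t * (L n \<omega> - t)"
          by (simp add: power2_eq_square algebra_simps)
        also have "t * (L n \<omega> - t) \<le> \<bar>t\<bar> * d"
          using 1 by (metis abs_ge_self abs_ge_zero abs_mult less_imp_le mult_left_mono order_trans)
        finally have "s n * (t * L n \<omega>) \<le> s n * (t\<^sup>2 + \<bar>t\<bar> * d)"
          using sn by (intro mult_left_mono) auto
        then have "exp (t * s n * L n \<omega>) \<le> ?c * indicator ?A \<omega>"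
          using 1 \<omega> by (simp add: algebra_simps)
        then show ?thesis
          by (smt (verit) exp_gt_zero mult_pos_pos)
      next
        case 2
        have "(s n * d) * (t + d) \<le> (s n * d) * L n \<omega>"
          using 2 sn d by (intro mult_left_mono) auto
        then have "exp (t * s n * L n \<omega>) \<le> ?p * exp ((t + d) * s n * L n \<omega>)"
          by (simp add: exp_add[symmetric] algebra_simps)
        then show ?thesis
          by (smt (verit) exp_gt_zero indicator_pos_le mult_pos_pos mult_nonneg_nonneg)
      next
        case 3
        have "(s n * d) * L n \<omega> \<le> (s n * d) * (t - d)"
          using 3 sn d by (intro mult_left_mono) auto
        then have "exp (t * s n * L n \<omega>) \<le> ?m * exp ((t - d) * s n * L n \<omega>)"
          by (simp add: exp_add[symmetric] algebra_simps)
        then show ?thesis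
          by (smt (verit) exp_gt_zero indicator_pos_le mult_pos_pos mult_nonneg_nonneg)
      qed
    qed (auto simp: emeasure_eq_measure int
        intro!: Bochner_Integration.integrable_add integrable_mult_right integrable_real_indicator)
    also have "\<dots> = ?c * prob ?A + ?p * ?E (t + d) + ?m * ?E (t - d)"
      by (simp add: int integrable_real_indicator emeasure_eq_measure)
    also have "?p * ?E (t + d) \<le> ?p * exp (s n * ((t + d)\<^sup>2 / 2 + \<eta>))"
      using Eup elim by (intro mult_left_mono) auto
    also have "\<dots> = exp (s n * (t\<^sup>2 / 2 - 3 * \<eta>))"
      using \<eta>(2) by (simp add: exp_add[symmetric] algebra_simps power2_eq_square add_divide_distrib)
    also have "?m * ?E (t - d) \<le> ?m * exp (s n * ((t - d)\<^sup>2 / 2 + \<eta>))"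
      using Eup elim by (intro mult_left_mono) auto
    also have "\<dots> = exp (s n * (t\<^sup>2 / 2 - 3 * \<eta>))"
      using \<eta>(2) by (simp add: exp_add[symmetric] algebra_simps power2_eq_square add_divide_distrib diff_divide_distrib)
    finally have E: "exp (s n * (t\<^sup>2 / 2 - \<eta>)) \<le> ?c * prob ?A + 2 * exp (s n * (t\<^sup>2 / 2 - 3 * \<eta>))"
      using Elo by simp
    have "4 * exp (s n * (t\<^sup>2 / 2 - 3 * \<eta>)) = exp (ln 4 + s n * (t\<^sup>2 / 2 - 3 * \<eta>))"
      by (simp add: exp_add)
    also have "\<dots> \<le> exp (s n * (t\<^sup>2 / 2 - \<eta>))"
      using sn by (simp add: algebra_simps)
    finally have half: "exp (s n * (t\<^sup>2 / 2 - \<eta>)) \<le> 2 * ?c * prob ?A"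
      using E by simp
    have "exp (- s n * (t\<^sup>2 / 2 + \<epsilon>)) \<le> exp (s n * (t\<^sup>2 / 2 - \<eta>) - s n * (t\<^sup>2 + \<bar>t\<bar> * d) - ln 2)"
    proof -
      have "s n * (\<eta> + \<bar>t\<bar> * d) \<le> s n * (\<epsilon> / 2)"
        using small sn by (intro mult_left_mono) auto
      then show ?thesis
        using sn by (simp add: algebra_simps)
    qed
    also have "\<dots> = exp (s n * (t\<^sup>2 / 2 - \<eta>)) / (2 * ?c)"
      by (simp add: exp_diff)
    also have "\<dots> \<le> prob ?A"
      using half by (simp add: field_simps)
    also have "prob ?A \<le> prob {\<omega> \<in> space M. \<bar>L n \<omega> - t\<bar> < \<delta>}"
      using d by (intro finite_measure_mono) auto
    finally show ?case .
  qed
qed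

text \<open>\<open>Z n\<close> and \<open>L n\<close> are exponentially equivalent at speed
  \<open>s n\<close>, so both Gaussian bounds pass to \<open>Z n\<close>. Arbitrary Borel sets
  follow because the rate function is even and increasing in \<open>\<bar>x\<bar>\<close>: the
  interior contains a ball about each of its points, and \<open>B\<close> lies in
  \<open>{x. m \<le> \<bar>x\<bar>}\<close>, where \<open>m\<close> is the distance from 0 to the
  closure and is attained there.\<close>

theorem moderate_deviation_principle_of_log_mgf:
  fixes L Z :: "nat \<Rightarrow> 'a \<Rightarrow> real"
  assumes s: "filterlim s at_top sequentially"
    and Z [measurable]: "\<And>n. Z n \<in> borel_measurable M"
    and int: "\<And>n t. integrable M (\<lambda>\<omega>. exp (t * L n \<omega>))"
    and mgf: "\<And>t. (\<lambda>n. ln (expectation (\<lambda>\<omega>. exp (t * s n * L n \<omega>))) / s n) \<longlonglongrightarrow> t\<^sup>2 / 2"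
    and negl: "\<And>\<delta> C. 0 < \<delta> \<Longrightarrow>
      \<forall>\<^sub>F n in sequentially. prob {\<omega> \<in> space M. \<delta> < \<bar>Z n \<omega> - L n \<omega>\<bar>} \<le> exp (- C * s n)"
  shows "moderate_deviation_principle M Z s (\<lambda>x. ereal (x\<^sup>2 / 2))"
proof -
  have [measurable]: "L n \<in> borel_measurable M" for n
    by (rule borel_measurable_of_integrable_exp[OF int])
  have s_large: "\<forall>\<^sub>F n in sequentially. c < s n" for c
    using s by (simp add: filterlim_at_top_dense)
  have lower: "\<forall>\<^sub>F n in sequentially.
      exp (- s n * (t\<^sup>2 / 2 + \<epsilon>)) \<le> prob {\<omega> \<in> space M. \<bar>Z n \<omega> - t\<bar> < \<delta>}"
    if "0 < \<delta>" "0 < \<epsilon>" for t \<delta> \<epsilon>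
  proof -
    have "\<forall>\<^sub>F n in sequentially.
        exp (- s n * (t\<^sup>2 / 2 + \<epsilon> / 2)) \<le> prob {\<omega> \<in> space M. \<bar>L n \<omega> - t\<bar> < \<delta> / 2}"
      using that by (intro gaussian_log_mgf_local_lower_bound[OF s int mgf]) auto
    moreover have "\<forall>\<^sub>F n in sequentially.
        prob {\<omega> \<in> space M. \<delta> / 2 < \<bar>Z n \<omega> - L n \<omega>\<bar>} \<le> exp (- (t\<^sup>2 / 2 + \<epsilon>) * s n)"
      using that by (intro negl) auto
    ultimately show ?thesis
      using s_large[of "2 * ln 2 / \<epsilon>"]
    proof eventually_elim
      case (elim n)
      \<comment> \<open>The exceptional event has exponent \<open>t\<^sup>2 / 2 + \<epsilon>\<close>
        and the window only \<open>t\<^sup>2 / 2 + \<epsilon> / 2\<close>; once the window bound is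
        twice the other, half of it survives the subtraction.\<close>
      have "2 * exp (- s n * (t\<^sup>2 / 2 + \<epsilon>)) = exp (ln 2 + - s n * (t\<^sup>2 / 2 + \<epsilon>))"
        by (simp only: exp_add exp_ln zero_less_numeral)
      also have "\<dots> \<le> exp (- s n * (t\<^sup>2 / 2 + \<epsilon> / 2))"
        using elim that by (simp add: field_simps)
      also have "\<dots> \<le> prob {\<omega> \<in> space M. \<bar>L n \<omega> - t\<bar> < \<delta> / 2}"
        using elim by simp
      also have "\<dots> \<le> prob ({\<omega> \<in> space M. \<bar>Z n \<omega> - t\<bar> < \<delta>} \<union> {\<omega> \<in> space M. \<delta> / 2 < \<bar>Z n \<omega> - L n \<omega>\<bar>})"
        by (intro finite_measure_mono) (auto simp: abs_if split: if_splits)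
      also have "\<dots> \<le> prob {\<omega> \<in> space M. \<bar>Z n \<omega> - t\<bar> < \<delta>} + prob {\<omega> \<in> space M. \<delta> / 2 < \<bar>Z n \<omega> - L n \<omega>\<bar>}"
        by (intro measure_Un_le) auto
      finally show ?case
        using elim by (simp add: algebra_simps)
    qed
  qed
  have upper: "\<forall>\<^sub>F n in sequentially.
      prob {\<omega> \<in> space M. x \<le> \<bar>Z n \<omega>\<bar>} \<le> exp (- s n * (x\<^sup>2 / 2 - \<epsilon>))"
    if "0 < x" "0 < \<epsilon>" for x \<epsilon>
  proof -
    \<comment> \<open>\<open>d \<le> x\<close> keeps the shifted level nonnegative, as the tail
      bound requires, and \<open>x * d \<le> \<epsilon> / 2\<close> limits the loss in the
      exponent.\<close>
    define d where "d = min x (\<epsilon> / (2 * x))"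
    have d: "0 < d" "d \<le> x" "d \<le> \<epsilon> / (2 * x)"
      using that by (auto simp: d_def)
    have "x\<^sup>2 / 2 - \<epsilon> / 2 \<le> x\<^sup>2 / 2 - x * d"
      using d that by (simp add: field_simps)
    also have "\<dots> \<le> (x - d)\<^sup>2 / 2"
      by (simp add: power2_eq_square field_simps)
    finally have xd: "x\<^sup>2 / 2 - \<epsilon> / 2 \<le> (x - d)\<^sup>2 / 2" .
    have mgf': "(\<lambda>n. ln (expectation (\<lambda>\<omega>. exp (t * s n * (- L n \<omega>)))) / s n) \<longlonglongrightarrow> t\<^sup>2 / 2" for t
      using mgf[of "-t"] by simp
    have int': "integrable M (\<lambda>\<omega>. exp (t * (- L n \<omega>)))" for n t
      using int[of "-t"] by simp
    have "\<forall>\<^sub>F n in sequentially. prob {\<omega> \<in> space M. x - d \<le> L n \<omega>} \<le> exp (- s n * ((x - d)\<^sup>2 / 2 - \<epsilon> / 4))"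
      using gaussian_log_mgf_upper_tail[OF s int mgf, of "x - d" "\<epsilon> / 4"] d that by simp
    moreover have "\<forall>\<^sub>F n in sequentially. prob {\<omega> \<in> space M. x - d \<le> - L n \<omega>} \<le> exp (- s n * ((x - d)\<^sup>2 / 2 - \<epsilon> / 4))"
      using gaussian_log_mgf_upper_tail[OF s int' mgf', of "x - d" "\<epsilon> / 4"] d that by simp
    moreover have "\<forall>\<^sub>F n in sequentially.
        prob {\<omega> \<in> space M. d < \<bar>Z n \<omega> - L n \<omega>\<bar>} \<le> exp (- (x\<^sup>2 / 2) * s n)"
      using negl[of d "x\<^sup>2 / 2"] d by simp
    ultimately show ?thesis
      using s_large[of "max 0 (4 * ln 3 / \<epsilon>)"]
    proof eventually_elim
      case (elim n)
      have "max 0 (4 * ln 3 / \<epsilon>) < s n" by (fact elim(4))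
      then have sn: "0 < s n" "4 * ln 3 < \<epsilon> * s n"
        using that by (simp_all only: max_less_iff_conj pos_divide_less_eq mult.commute[of \<epsilon>])
      \<comment> \<open>A common bound for the three events below; the remaining
        \<open>\<epsilon> / 4\<close> pays for the factor 3.\<close>
      let ?e = "exp (- s n * (x\<^sup>2 / 2 - 3 * \<epsilon> / 4))"
      have "prob {\<omega> \<in> space M. x \<le> \<bar>Z n \<omega>\<bar>} \<le> prob (({\<omega> \<in> space M. x - d \<le> L n \<omega>}
          \<union> {\<omega> \<in> space M. x - d \<le> - L n \<omega>}) \<union> {\<omega> \<in> space M. d < \<bar>Z n \<omega> - L n \<omega>\<bar>})"
        by (intro finite_measure_mono) auto
      also have "\<dots> \<le> prob ({\<omega> \<in> space M. x - d \<le> L n \<omega>}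
          \<union> {\<omega> \<in> space M. x - d \<le> - L n \<omega>}) + prob {\<omega> \<in> space M. d < \<bar>Z n \<omega> - L n \<omega>\<bar>}"
        by (intro measure_Un_le) auto
      also have "prob ({\<omega> \<in> space M. x - d \<le> L n \<omega>} \<union> {\<omega> \<in> space M. x - d \<le> - L n \<omega>})
          \<le> prob {\<omega> \<in> space M. x - d \<le> L n \<omega>} + prob {\<omega> \<in> space M. x - d \<le> - L n \<omega>}"
        by (intro measure_Un_le) auto
      also have "prob {\<omega> \<in> space M. x - d \<le> L n \<omega>} \<le> ?e"
        using elim(1) mult_left_mono[of "x\<^sup>2 / 2 - 3 * \<epsilon> / 4" "(x - d)\<^sup>2 / 2 - \<epsilon> / 4" "s n"] xd sn
        by (elim order_trans) auto
      also have "prob {\<omega> \<in> space M. x - d \<le> - L n \<omega>} \<le> ?e"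
        using elim(2) mult_left_mono[of "x\<^sup>2 / 2 - 3 * \<epsilon> / 4" "(x - d)\<^sup>2 / 2 - \<epsilon> / 4" "s n"] xd sn
        by (elim order_trans) auto
      also have "prob {\<omega> \<in> space M. d < \<bar>Z n \<omega> - L n \<omega>\<bar>} \<le> ?e"
        using elim(3) mult_left_mono[of "x\<^sup>2 / 2 - 3 * \<epsilon> / 4" "x\<^sup>2 / 2" "s n"] sn that
        by (elim order_trans) (auto simp: mult.commute)
      finally have "prob {\<omega> \<in> space M. x \<le> \<bar>Z n \<omega>\<bar>} \<le> 3 * ?e" by simp
      also have "\<dots> = exp (ln 3 + - s n * (x\<^sup>2 / 2 - 3 * \<epsilon> / 4))"
        by (simp only: exp_add exp_ln zero_less_numeral)
      also have "\<dots> \<le> exp (- s n * (x\<^sup>2 / 2 - \<epsilon>))"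
        using sn by (simp add: algebra_simps)
      finally show ?case .
    qed
  qed
  show ?thesis
    unfolding moderate_deviation_principle_def
  proof (intro conjI ballI allI)
    fix B :: "real set" assume [measurable]: "B \<in> sets borel"
    let ?p = "\<lambda>n. prob {\<omega> \<in> space M. Z n \<omega> \<in> B}"
    let ?u = "\<lambda>n. ereal (1 / s n) * log_prob (?p n)"
    show "- (INF x\<in>interior B. ereal (x\<^sup>2 / 2)) \<le> liminf ?u"
    proof (subst ereal_uminus_le_reorder, rule INF_greatest)
      fix t assume "t \<in> interior B"
      then obtain \<delta> where \<delta>: "0 < \<delta>" "ball t \<delta> \<subseteq> B"
        by (auto simp: mem_interior)
      have "ereal (- (t\<^sup>2 / 2)) \<le> liminf ?u"
      proof (rule ereal_le_epsilon2)
        fix \<epsilon> :: real assume "0 < \<epsilon>"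
        have "\<forall>\<^sub>F n in sequentially. ereal (- (t\<^sup>2 / 2) - \<epsilon>) \<le> ?u n"
          using lower[OF \<delta>(1) \<open>0 < \<epsilon>\<close>, of t] s_large[of 0]
        proof eventually_elim
          case (elim n)
          have "prob {\<omega> \<in> space M. \<bar>Z n \<omega> - t\<bar> < \<delta>} \<le> ?p n"
            using \<delta>(2) by (intro finite_measure_mono) (auto simp: dist_real_def abs_minus_commute subset_eq)
          with elim have *: "exp (- s n * (t\<^sup>2 / 2 + \<epsilon>)) \<le> ?p n" by simp
          then have "0 < ?p n"
            by (meson exp_gt_zero less_le_trans)
          then have "- s n * (t\<^sup>2 / 2 + \<epsilon>) \<le> ln (?p n)"
            using * by (simp add: ln_ge_iff)
          then show ?case
            using \<open>0 < ?p n\<close> elim(2) by (simp add: log_prob_def field_simps)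
        qed
        then have "ereal (- (t\<^sup>2 / 2) - \<epsilon>) \<le> liminf ?u"
          by (rule Liminf_bounded)
        then have "ereal (- (t\<^sup>2 / 2) - \<epsilon>) + ereal \<epsilon> \<le> liminf ?u + ereal \<epsilon>"
          by (rule add_right_mono)
        then show "ereal (- (t\<^sup>2 / 2)) \<le> liminf ?u + ereal \<epsilon>" by simp
      qed
      then show "- liminf ?u \<le> ereal (t\<^sup>2 / 2)"
        by (subst ereal_uminus_le_reorder) simp
    qed
    show "limsup ?u \<le> - (INF x\<in>closure B. ereal (x\<^sup>2 / 2))"
    \<comment> \<open>\<open>infdist\<close> to the empty set is 0 while the infimum over it is
      \<open>\<infinity>\<close>, so this case is separate.\<close>
    proof (cases "B = {}")
      case True
      have "\<forall>\<^sub>F n in sequentially. ?u n \<le> - \<infinity>"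
        using s_large[of 0] by eventually_elim (simp add: log_prob_def True)
      then have "limsup ?u \<le> - \<infinity>"
        by (rule Limsup_bounded)
      then show ?thesis by simp
    next
      case False
      define m where "m = infdist 0 (closure B)"
      have m: "m \<le> \<bar>x\<bar>" if "x \<in> closure B" for x
        using infdist_le[OF that, of 0] by (simp add: m_def)
      have "0 \<le> m" by (simp add: m_def infdist_nonneg)
      have "(INF x\<in>closure B. ereal (x\<^sup>2 / 2)) \<le> ereal (m\<^sup>2 / 2)"
      proof -
        obtain x where x: "x \<in> closure B" "m = dist 0 x"
          using infdist_attains_inf[of "closure B" 0] False by (auto simp: m_def)
        then show ?thesis
          by (intro INF_lower2[OF x(1)]) simp
      qed
      moreover have "limsup ?u \<le> ereal (- (m\<^sup>2 / 2))"
      proof (rule ereal_le_epsilon2)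
        fix \<epsilon> :: real assume "0 < \<epsilon>"
        have "\<forall>\<^sub>F n in sequentially. ?p n \<le> exp (- s n * (m\<^sup>2 / 2 - \<epsilon>))"
        \<comment> \<open>\<open>upper\<close> covers positive levels only; at level 0 the trivial
          bound 1 takes its place.\<close>
        proof (cases "m = 0")
          case True
          show ?thesis
            using s_large[of 0]
          proof eventually_elim
            case (elim n)
            have "?p n \<le> 1" by simp
            also have "1 \<le> exp (- s n * (m\<^sup>2 / 2 - \<epsilon>))"
              using True elim \<open>0 < \<epsilon>\<close> by simp
            finally show ?case .
          qed
        next
          case False
          with \<open>0 \<le> m\<close> have "0 < m" by simp
          show ?thesis
            using upper[OF \<open>0 < m\<close> \<open>0 < \<epsilon>\<close>]
          proof eventually_elim
            case (elim n)
            have "?p n \<le> prob {\<omega> \<in> space M. m \<le> \<bar>Z n \<omega>\<bar>}"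
              using m closure_subset[of B] by (intro finite_measure_mono) auto
            with elim show ?case by simp
          qed
        qed
        then have "\<forall>\<^sub>F n in sequentially. ?u n \<le> ereal (- (m\<^sup>2 / 2) + \<epsilon>)"
          using s_large[of 0]
        proof eventually_elim
          case (elim n)
          show ?case
          proof (cases "?p n = 0")
            case True
            then show ?thesis using elim by (simp add: log_prob_def)
          next
            case False
            then have "0 < ?p n" by (simp add: zero_less_measure_iff)
            then have "ln (?p n) \<le> - s n * (m\<^sup>2 / 2 - \<epsilon>)"
              using elim by (metis exp_gt_zero ln_exp ln_le_cancel_iff)
            then show ?thesis
              using False elim(2) by (simp add: log_prob_def field_simps)
          qed
        qed
        then have "limsup ?u \<le> ereal (- (m\<^sup>2 / 2) + \<epsilon>)"
          by (rule Limsup_bounded)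
        then show "limsup ?u \<le> ereal (- (m\<^sup>2 / 2)) + ereal \<epsilon>" by simp
      qed
      ultimately show ?thesis
        unfolding uminus_ereal.simps(1)[symmetric]
        by (meson ereal_minus_le_minus order_trans)
    qed
  qed (use s in auto)
qed

section \<open>Logarithmic moment generating functions of sums of bounded variables\<close>

text \<open>Second order Taylor expansion of the exponential, followed by
  \<open>\<bar>ln (1 + y) - y\<bar> \<le> 2 * y\<^sup>2\<close> for
  \<open>\<bar>y\<bar> \<le> 1 / 2\<close>. The error is explicit because it will be added up over
  \<open>n\<close> summands; being of third order, it is a vanishing fraction of the quadratic term
  as \<open>\<theta>\<close> tends to 0.\<close>

lemma log_mgf_bounded_centered:
  fixes g :: "'a \<Rightarrow> real"
  assumes g [measurable]: "g \<in> borel_measurable M"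
    and bound: "\<And>\<omega>. \<omega> \<in> space M \<Longrightarrow> \<bar>g \<omega>\<bar> \<le> C" and "1 \<le> C"
    and mean: "expectation g = 0" and v: "expectation (\<lambda>\<omega>. (g \<omega>)\<^sup>2) = v"
    and \<theta>: "\<bar>\<theta>\<bar> \<le> 1" "\<theta>\<^sup>2 * (2 * exp C * C ^ 3) \<le> 1 / 2"
  shows "\<bar>ln (expectation (\<lambda>\<omega>. exp (\<theta> * g \<omega>))) - \<theta>\<^sup>2 * v / 2\<bar> \<le> 9 * (exp C * C ^ 3)\<^sup>2 * \<bar>\<theta>\<bar> ^ 3"
proof -
  \<comment> \<open>Since \<open>1 \<le> C\<close>, this constant dominates 1,
    \<open>C\<^sup>2\<close> and the Taylor remainder at once.\<close>
  define D where "D = exp C * C ^ 3"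
  have D: "1 \<le> D" "0 \<le> C" "C\<^sup>2 \<le> D"
  proof -
    have "C\<^sup>2 \<le> C ^ 3" "1 \<le> C ^ 3"
      using \<open>1 \<le> C\<close> by (auto intro: power_increasing)
    moreover have "1 \<le> exp C" using \<open>1 \<le> C\<close> by simp
    ultimately show "1 \<le> D" "C\<^sup>2 \<le> D" "0 \<le> C"
      using mult_mono[of 1 "exp C" 1 "C ^ 3"] mult_mono[of 1 "exp C" "C\<^sup>2" "C ^ 3"] \<open>1 \<le> C\<close>
      by (auto simp: D_def)
  qed
  have integrable_bd: "integrable M h" if "h \<in> borel_measurable M" "\<And>\<omega>. \<omega> \<in> space M \<Longrightarrow> \<bar>h \<omega>\<bar> \<le> B"
    for h :: "'a \<Rightarrow> real" and B
    using that by (intro integrable_const_bound[of _ B]) auto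
  have \<theta>g: "\<bar>\<theta> * g \<omega>\<bar> \<le> C" if "\<omega> \<in> space M" for \<omega>
    using mult_mono[OF \<theta>(1) bound[OF that]] by (simp add: abs_mult)
  have ig: "integrable M g" "integrable M (\<lambda>\<omega>. (g \<omega>)\<^sup>2)" "integrable M (\<lambda>\<omega>. exp (\<theta> * g \<omega>))"
  proof -
    show "integrable M g" using bound by (intro integrable_bd) auto
    show "integrable M (\<lambda>\<omega>. (g \<omega>)\<^sup>2)"
      using power_mono[OF bound, of _ 2] by (intro integrable_bd[of _ "C\<^sup>2"]) auto
    show "integrable M (\<lambda>\<omega>. exp (\<theta> * g \<omega>))"
      using \<theta>g by (intro integrable_bd[of _ "exp C"]) (auto simp: abs_le_iff)
  qed
  define y where "y = expectation (\<lambda>\<omega>. exp (\<theta> * g \<omega>)) - 1"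
  have v_bd: "\<bar>v\<bar> \<le> D"
  proof -
    have "v \<le> expectation (\<lambda>_. C\<^sup>2)"
      unfolding v[symmetric] using ig power_mono[OF bound, of _ 2] by (intro integral_mono) auto
    moreover have "0 \<le> v" unfolding v[symmetric] by simp
    ultimately show ?thesis using D prob_space by simp
  qed
  have taylor: "\<bar>exp x - (1 + x + x\<^sup>2 / 2)\<bar> \<le> exp \<bar>x\<bar> * \<bar>x\<bar> ^ 3" for x :: real
  proof -
    obtain t where t: "\<bar>t\<bar> \<le> \<bar>x\<bar>" "exp x = (\<Sum>m<3. x ^ m / fact m) + exp t / fact 3 * x ^ 3"
      using Maclaurin_exp_le[of x 3] by auto
    have exp_div6_le: "exp t / 6 \<le> exp \<bar>x\<bar>"
    proof -
      have "exp t \<le> exp \<bar>x\<bar>" using t(1) by simp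
      moreover have "0 < exp t" by simp
      ultimately show ?thesis by linarith
    qed
    have "exp x - (1 + x + x\<^sup>2 / 2) = exp t / 6 * x ^ 3"
      unfolding t(2) by (simp add: eval_nat_numeral fact_reduce)
    also have "\<bar>\<dots>\<bar> = exp t / 6 * \<bar>x\<bar> ^ 3"
      by (simp add: abs_mult power_abs)
    also have "\<dots> \<le> exp \<bar>x\<bar> * \<bar>x\<bar> ^ 3"
      using t(1) by (intro mult_right_mono exp_div6_le) auto
    finally show ?thesis .
  qed
  have "y - \<theta>\<^sup>2 * v / 2 = expectation (\<lambda>\<omega>. exp (\<theta> * g \<omega>) - (1 + \<theta> * g \<omega> + (\<theta> * g \<omega>)\<^sup>2 / 2))"
    using ig by (simp add: y_def mean v power_mult_distrib prob_space)
  also have "\<bar>\<dots>\<bar> \<le> expectation (\<lambda>\<omega>. \<bar>exp (\<theta> * g \<omega>) - (1 + \<theta> * g \<omega> + (\<theta> * g \<omega>)\<^sup>2 / 2)\<bar>)"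
    by (rule integral_abs_bound)
  also have "\<dots> \<le> expectation (\<lambda>\<omega>. D * \<bar>\<theta>\<bar> ^ 3)"
  proof (rule integral_mono)
    fix \<omega> assume \<omega>: "\<omega> \<in> space M"
    have "\<bar>exp (\<theta> * g \<omega>) - (1 + \<theta> * g \<omega> + (\<theta> * g \<omega>)\<^sup>2 / 2)\<bar> \<le> exp \<bar>\<theta> * g \<omega>\<bar> * \<bar>\<theta> * g \<omega>\<bar> ^ 3"
      by (rule taylor)
    also have "\<dots> \<le> exp C * (\<bar>\<theta>\<bar> * C) ^ 3"
      using \<theta>g[OF \<omega>] bound[OF \<omega>] D by (intro mult_mono power_mono) (auto simp: abs_mult intro: mult_left_mono)
    finally show "\<bar>exp (\<theta> * g \<omega>) - (1 + \<theta> * g \<omega> + (\<theta> * g \<omega>)\<^sup>2 / 2)\<bar> \<le> D * \<bar>\<theta>\<bar> ^ 3"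
      by (simp add: D_def power_mult_distrib mult_ac)
  qed (use ig in \<open>auto simp: power_mult_distrib\<close>)
  also have "\<dots> = D * \<bar>\<theta>\<bar> ^ 3" by (simp add: prob_space)
  finally have y1: "\<bar>y - \<theta>\<^sup>2 * v / 2\<bar> \<le> D * \<bar>\<theta>\<bar> ^ 3" .
  have t3: "\<bar>\<theta>\<bar> ^ 3 \<le> \<theta>\<^sup>2"
    using power_decreasing[of 2 3 "\<bar>\<theta>\<bar>"] \<theta> by simp
  have "\<bar>y\<bar> \<le> D * \<bar>\<theta>\<bar> ^ 3 + \<bar>\<theta>\<^sup>2 * v / 2\<bar>" using y1 by linarith
  also have "\<dots> \<le> D * \<theta>\<^sup>2 + \<theta>\<^sup>2 * D"
  proof (intro add_mono mult_left_mono t3)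
    have "\<theta>\<^sup>2 * \<bar>v\<bar> \<le> \<theta>\<^sup>2 * (2 * D)"
      using v_bd D by (intro mult_left_mono) auto
    then show "\<bar>\<theta>\<^sup>2 * v / 2\<bar> \<le> \<theta>\<^sup>2 * D" by (simp add: abs_mult)
  qed (use D in auto)
  finally have y2: "\<bar>y\<bar> \<le> 2 * D * \<theta>\<^sup>2" by simp
  then have "\<bar>y\<bar> \<le> 1 / 2" using \<theta>(2) by (simp add: D_def mult_ac)
  then have "\<bar>ln (1 + y) - y\<bar> \<le> 2 * y\<^sup>2"
    by (rule abs_ln_one_plus_x_minus_x_bound)
  also have "\<dots> \<le> 2 * (2 * D * \<theta>\<^sup>2)\<^sup>2"
    using power_mono[OF y2, of 2] by simp
  also have "\<dots> = 8 * D\<^sup>2 * \<bar>\<theta>\<bar> ^ 4"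
    by (simp add: power_mult_distrib power_even_abs flip: power_mult)
  also have "\<dots> \<le> 8 * D\<^sup>2 * \<bar>\<theta>\<bar> ^ 3"
    using power_decreasing[of 3 4 "\<bar>\<theta>\<bar>"] \<theta> by (intro mult_left_mono) auto
  finally have "\<bar>ln (1 + y) - \<theta>\<^sup>2 * v / 2\<bar> \<le> (D + 8 * D\<^sup>2) * \<bar>\<theta>\<bar> ^ 3"
    using y1 by (simp add: algebra_simps)
  also have "\<dots> \<le> 9 * D\<^sup>2 * \<bar>\<theta>\<bar> ^ 3"
    using D mult_left_mono[of 1 D D] by (intro mult_right_mono) (auto simp: power2_eq_square)
  finally show ?thesis by (simp add: y_def D_def)
qed

text \<open>By independence the logarithms add up, each being
  \<open>\<theta>\<^sup>2 * v / 2\<close> up to third order with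
  \<open>\<theta> = t * s n * c n\<close>. The second limit in \<open>c\<close> makes the sum of the
  main terms, divided by \<open>s n\<close>, tend to \<open>t\<^sup>2 / 2\<close>; the error is at
  most a constant times the same quantity times \<open>\<bar>\<theta>\<bar>\<close>, which vanishes
  by the first limit.\<close>

lemma log_mgf_weighted_sum_tendsto:
  fixes G :: "nat \<Rightarrow> 'a \<Rightarrow> real"
  assumes indep: "indep_vars (\<lambda>_. borel) G {1..}"
    and bound: "\<And>i \<omega>. 1 \<le> i \<Longrightarrow> \<omega> \<in> space M \<Longrightarrow> \<bar>G i \<omega>\<bar> \<le> C"
    and mean: "\<And>i. 1 \<le> i \<Longrightarrow> expectation (G i) = 0"
    and v: "\<And>i. 1 \<le> i \<Longrightarrow> expectation (\<lambda>\<omega>. (G i \<omega>)\<^sup>2) = v" "0 < v"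
    and s: "\<forall>\<^sub>F n in sequentially. 0 < s n"
    and c: "(\<lambda>n. s n * c n) \<longlonglongrightarrow> 0" "(\<lambda>n. real n * s n * (c n)\<^sup>2 * v) \<longlonglongrightarrow> 1"
  shows "(\<lambda>n. ln (expectation (\<lambda>\<omega>. exp (t * s n * (c n * (\<Sum>i=1..n. G i \<omega>))))) / s n) \<longlonglongrightarrow> t\<^sup>2 / 2"
proof -
  \<comment> \<open>\<open>log_mgf_bounded_centered\<close> asks for a bound of at least 1.\<close>
  define B where "B = max 1 C"
  define D where "D = exp B * B ^ 3"
  define \<theta> where "\<theta> n = t * s n * c n" for n
  have B: "1 \<le> B" "\<And>i \<omega>. 1 \<le> i \<Longrightarrow> \<omega> \<in> space M \<Longrightarrow> \<bar>G i \<omega>\<bar> \<le> B"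
    using bound by (auto simp: B_def intro: max.coboundedI2)
  have Gm [measurable]: "G i \<in> borel_measurable M" if "1 \<le> i" for i
    using indep that by (auto simp: indep_vars_def)
  have \<theta>0: "\<theta> \<longlonglongrightarrow> 0"
    using tendsto_mult_left[OF c(1), of t] by (simp add: \<theta>_def[abs_def] mult.assoc)
  have lim: "(\<lambda>n. real n * (\<theta> n)\<^sup>2 / s n * v) \<longlonglongrightarrow> t\<^sup>2"
  proof (rule Lim_transform_eventually)
    show "(\<lambda>n. t\<^sup>2 * (real n * s n * (c n)\<^sup>2 * v)) \<longlonglongrightarrow> t\<^sup>2"
      using tendsto_mult_left[OF c(2), of "t\<^sup>2"] by simp
    show "\<forall>\<^sub>F n in sequentially. t\<^sup>2 * (real n * s n * (c n)\<^sup>2 * v) = real n * (\<theta> n)\<^sup>2 / s n * v"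
      using s by eventually_elim (simp add: \<theta>_def power2_eq_square)
  qed
  have err: "(\<lambda>n. 9 * D\<^sup>2 / v * (real n * (\<theta> n)\<^sup>2 / s n * v) * \<bar>\<theta> n\<bar>) \<longlonglongrightarrow> 0"
    using tendsto_mult[OF tendsto_mult_left[OF lim, of "9 * D\<^sup>2 / v"] tendsto_rabs[OF \<theta>0]] by simp
  have "(\<lambda>n. (\<theta> n)\<^sup>2 * (2 * D)) \<longlonglongrightarrow> 0"
    using tendsto_mult_right[OF tendsto_power[OF \<theta>0, of 2], of "2 * D"] by simp
  then have ev1: "\<forall>\<^sub>F n in sequentially. (\<theta> n)\<^sup>2 * (2 * D) < 1 / 2"
    by (rule order_tendstoD) simp
  have ev2: "\<forall>\<^sub>F n in sequentially. \<bar>\<theta> n\<bar> < 1"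
    using tendsto_rabs[OF \<theta>0] by (rule order_tendstoD) simp
  let ?\<Lambda> = "\<lambda>n. ln (expectation (\<lambda>\<omega>. exp (t * s n * (c n * (\<Sum>i=1..n. G i \<omega>))))) / s n"
  have "\<forall>\<^sub>F n in sequentially. norm (?\<Lambda> n - real n * (\<theta> n)\<^sup>2 / s n * v / 2)
      \<le> 9 * D\<^sup>2 / v * (real n * (\<theta> n)\<^sup>2 / s n * v) * \<bar>\<theta> n\<bar>"
    using s ev1 ev2
  proof eventually_elim
    case (elim n)
    let ?M = "\<lambda>i. expectation (\<lambda>\<omega>. exp (\<theta> n * G i \<omega>))"
    have int: "integrable M (\<lambda>\<omega>. exp (\<theta> n * G i \<omega>))" if "1 \<le> i" for i
    proof (rule integrable_const_bound[of _ "exp B"])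
      show "AE \<omega> in M. norm (exp (\<theta> n * G i \<omega>)) \<le> exp B"
      proof (rule AE_I2)
        fix \<omega> assume "\<omega> \<in> space M"
        then have "\<bar>\<theta> n * G i \<omega>\<bar> \<le> 1 * B"
          unfolding abs_mult using elim B that by (intro mult_mono) auto
        then show "norm (exp (\<theta> n * G i \<omega>)) \<le> exp B" by simp
      qed
    qed (use that in measurable)
    have pos: "0 < ?M i" if "1 \<le> i" for i
      using integral_less_AE_space[of "\<lambda>_. 0" "\<lambda>\<omega>. exp (\<theta> n * G i \<omega>)"] int[OF that]
      by (simp add: emeasure_space_1)
    have ind: "indep_vars (\<lambda>_. borel) (\<lambda>i \<omega>. exp (\<theta> n * G i \<omega>)) {1..n}"
      by (rule indep_vars_compose2[OF indep_vars_subset[OF indep]]) auto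
    have "expectation (\<lambda>\<omega>. exp (t * s n * (c n * (\<Sum>i=1..n. G i \<omega>)))) = expectation (\<lambda>\<omega>. \<Prod>i=1..n. exp (\<theta> n * G i \<omega>))"
      by (simp add: \<theta>_def exp_sum[symmetric] sum_distrib_left mult.assoc)
    also have "\<dots> = (\<Prod>i=1..n. ?M i)"
      using int by (intro indep_vars_lebesgue_integral ind) auto
    finally have "?\<Lambda> n = ln (\<Prod>i=1..n. ?M i) / s n"
      by simp
    also have "ln (\<Prod>i=1..n. ?M i) = (\<Sum>i=1..n. ln (?M i))"
      using pos by (intro ln_prod) (force simp: less_le)+
    finally have "?\<Lambda> n = (\<Sum>i=1..n. ln (?M i)) / s n" .
    then have "?\<Lambda> n - real n * (\<theta> n)\<^sup>2 / s n * v / 2 = (\<Sum>i=1..n. ln (?M i) - (\<theta> n)\<^sup>2 * v / 2) / s n"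
      unfolding sum_subtractf using elim by (simp add: diff_divide_distrib)
    also have "norm \<dots> \<le> (\<Sum>i=1..n. \<bar>ln (?M i) - (\<theta> n)\<^sup>2 * v / 2\<bar>) / s n"
      using elim by (simp add: divide_right_mono)
    also have "\<dots> \<le> (\<Sum>i=1..n. 9 * D\<^sup>2 * \<bar>\<theta> n\<bar> ^ 3) / s n"
      unfolding D_def using elim
      by (intro divide_right_mono sum_mono log_mgf_bounded_centered Gm B mean v) (auto simp: D_def)
    also have "\<dots> = 9 * D\<^sup>2 / v * (real n * (\<theta> n)\<^sup>2 / s n * v) * \<bar>\<theta> n\<bar>"
      using v(2) by (simp add: power3_eq_cube power2_eq_square)
    finally show ?case .
  qed
  then have "(\<lambda>n. ?\<Lambda> n - real n * (\<theta> n)\<^sup>2 / s n * v / 2) \<longlonglongrightarrow> 0"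
    by (rule Lim_null_comparison[OF _ err])
  from tendsto_add[OF this tendsto_divide[OF lim tendsto_const[of 2]]] show ?thesis
    by simp
qed

end

section \<open>Counting tuples of indices\<close>

text \<open>Each point of the union lies in two of the sets or is private to one of them, so adding the
  sizes of the sets to the sizes of their private parts counts it at least twice.\<close>
lemma card_UNION_le_of_shared:
  fixes R :: "'j \<Rightarrow> 'b set"
  assumes J: "finite J" and k: "2 \<le> k"
    and R: "\<And>j. j \<in> J \<Longrightarrow> finite (R j)" "\<And>j. j \<in> J \<Longrightarrow> card (R j) \<le> k"
    and shared: "\<And>j. j \<in> J \<Longrightarrow> card (R j - (\<Union>i\<in>J - {j}. R i)) \<le> k - 2"
  shows "card (\<Union>j\<in>J. R j) \<le> card J * (k - 1)"
proof -
  let ?T = "\<Union>j\<in>J. R j" and ?Q = "\<lambda>j. R j - (\<Union>i\<in>J - {j}. R i)"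
  have T: "finite ?T" using J R by auto
  have "2 * card ?T = (\<Sum>v\<in>?T. 2)" by simp
  also have "\<dots> \<le> (\<Sum>v\<in>?T. \<Sum>j\<in>J. of_bool (v \<in> R j) + of_bool (v \<in> ?Q j))"
  proof (rule sum_mono)
    fix v assume "v \<in> ?T"
    then obtain j where j: "j \<in> J" "v \<in> R j" by auto
    let ?h = "\<lambda>i. of_bool (v \<in> R i) + of_bool (v \<in> ?Q i) :: nat"
    show "2 \<le> sum ?h J"
    proof (cases "v \<in> ?Q j")
      case True
      then show ?thesis
        using member_le_sum[of j J ?h] j J by auto
    next
      case False
      then obtain i where i: "i \<in> J" "i \<noteq> j" "v \<in> R i" using j by auto
      have "(2::nat) \<le> sum ?h {i, j}" using i j by simp
      also have "\<dots> \<le> sum ?h J" using i j J by (intro sum_mono2) auto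
      finally show ?thesis .
    qed
  qed
  also have "\<dots> = (\<Sum>j\<in>J. \<Sum>v\<in>?T. of_bool (v \<in> R j) + of_bool (v \<in> ?Q j))"
    by (rule sum.swap)
  also have "\<dots> = (\<Sum>j\<in>J. card (R j) + card (?Q j))"
  proof (rule sum.cong[OF refl])
    fix j assume "j \<in> J"
    then have sub: "R j \<subseteq> ?T" "?Q j \<subseteq> ?T" by auto
    have *: "(\<Sum>v\<in>?T. of_bool (v \<in> S)) = card S" if "S \<subseteq> ?T" for S
      using that T by (simp add: Int_absorb1)
    show "(\<Sum>v\<in>?T. of_bool (v \<in> R j) + of_bool (v \<in> ?Q j)) = card (R j) + card (?Q j)"
      unfolding sum.distrib *[OF sub(1)] *[OF sub(2)] ..
  qed
  also have "\<dots> \<le> (\<Sum>j\<in>J. k + (k - 2))"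
    using R shared by (intro sum_mono add_mono) auto
  also have "\<dots> = 2 * (card J * (k - 1))"
  proof -
    have "k + (k - 2) = 2 * (k - 1)" using k by simp
    then show ?thesis by simp
  qed
  finally show ?thesis by simp
qed

text \<open>A map with at most \<open>v\<close> values factors through \<open>{..<v}\<close>: a
  labelling \<open>a\<close> of the points, then a decoding \<open>c\<close> of the labels. There
  are \<open>v ^ card A\<close> labellings and \<open>card C ^ v\<close> decodings; that several
  pairs give the same map is harmless for an upper bound.\<close>

lemma card_small_image_functions_le:
  fixes A :: "'b set" and C :: "'c set"
  assumes A: "finite A" "A \<noteq> {}" and C: "finite C" 
  shows "card {g \<in> A \<rightarrow>\<^sub>E C. card (g ` A) \<le> v} \<le> card C ^ v * v ^ card A"
proof -
  define G where "G = {g \<in> A \<rightarrow>\<^sub>E C. card (g ` A) \<le> v}"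
  let ?\<Phi> = "\<lambda>(a, c). \<lambda>x\<in>A. c (a x)"
  let ?D = "(A \<rightarrow>\<^sub>E {..<v}) \<times> ({..<v} \<rightarrow>\<^sub>E C)"
  have "G \<subseteq> ?\<Phi> ` ?D"
  proof
    fix g assume g: "g \<in> G"
    show "g \<in> ?\<Phi> ` ?D"
    proof -
      let ?T = "g ` A"
      have T: "finite ?T" "?T \<noteq> {}" "card ?T \<le> v" "?T \<subseteq> C"
        using g A by (auto simp: G_def)
      obtain b where b: "bij_betw b {..<card ?T} ?T"
        using ex_bij_betw_nat_finite[OF T(1)] by (auto simp: atLeast0LessThan)
      obtain y where y: "y \<in> ?T" using T by auto
      \<comment> \<open>Labels beyond the size of the image decode to the fixed point
        \<open>y\<close> of the image, so that \<open>c\<close> is defined on all of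
        \<open>{..<v}\<close> with values in \<open>C\<close>.\<close>
      define c where "c = (\<lambda>i\<in>{..<v}. if i < card ?T then b i else y)"
      define a where "a = (\<lambda>x\<in>A. inv_into {..<card ?T} b (g x))"
      have a: "a x < card ?T" "b (a x) = g x" if "x \<in> A" for x
      proof -
        have gx: "g x \<in> b ` {..<card ?T}"
          using b that by (simp add: bij_betw_def)
        show "a x < card ?T" "b (a x) = g x"
          using inv_into_into[OF gx] f_inv_into_f[OF gx] that by (auto simp: a_def)
      qed
      have "a \<in> A \<rightarrow>\<^sub>E {..<v}"
        using a(1) T(3) by (fastforce simp: a_def intro: less_le_trans)
      moreover have "c \<in> {..<v} \<rightarrow>\<^sub>E C"
        using subsetD[OF T(4)] bij_betwE[OF b] y by (simp add: c_def restrict_PiE_iff)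
      moreover have "g = (\<lambda>x\<in>A. c (a x))"
      proof
        fix x
        show "g x = (\<lambda>x\<in>A. c (a x)) x"
        proof (cases "x \<in> A")
          case True
          with a[OF True] T(3) show ?thesis by (simp add: c_def)
        next
          case False
          with g show ?thesis by (auto simp: G_def PiE_def extensional_def)
        qed
      qed
      ultimately show ?thesis by (intro image_eqI[of _ _ "(a, c)"]) auto
    qed
  qed
  then have "card G \<le> card (?\<Phi> ` ?D)"
    using A C by (intro card_mono finite_imageI finite_cartesian_product finite_PiE) auto
  also have "\<dots> \<le> card ?D"
    using A C by (intro card_image_le finite_cartesian_product finite_PiE) auto
  also have "\<dots> = card C ^ v * v ^ card A"
    using A C by (simp add: card_cartesian_product card_PiE mult.commute)
  finally show ?thesis by (simp add: G_def)
qed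

section \<open>Injective index tuples and their fibers\<close>

lemma card_distinct_tuples:
  "card (distinct_tuples n k) = (\<Prod>j<k. n - j)"
  using card_inj_on_subset_funcset[of "{1..k}" "{1..n}" "{1..k}"]
  by (simp add: distinct_tuples_def atLeast0LessThan)

lemma finite_distinct_tuples: "finite (distinct_tuples n k)"
  by (rule finite_subset[of _ "{1..k} \<rightarrow>\<^sub>E {1..n}"]) (auto simp: distinct_tuples_def intro: finite_PiE)

lemma distinct_tuples_range: "\<beta> \<in> distinct_tuples n k \<Longrightarrow> u \<in> {1..k} \<Longrightarrow> \<beta> u \<in> {1..n}"
  unfolding distinct_tuples_def by (rule PiE_mem[where S = "{1..k}" and T = "\<lambda>_. {1..n}"]) simp_all

text \<open>Composition with the transposition of \<open>i\<close> and \<open>j\<close> maps one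
  fiber injectively into the other; exchanging \<open>i\<close> and \<open>j\<close> later gives
  equality.\<close>

lemma card_distinct_tuples_fiber_le:
  assumes "u \<in> {1..k}" "i \<in> {1..n}" "j \<in> {1..n}"
  shows "card {\<beta> \<in> distinct_tuples n k. \<beta> u = i} \<le> card {\<beta> \<in> distinct_tuples n k. \<beta> u = j}"
proof (rule card_inj_on_le[where f = "\<lambda>\<beta>. \<lambda>v\<in>{1..k}. Transposition.transpose i j (\<beta> v)"])
  let ?T = "\<lambda>\<beta>. \<lambda>v\<in>{1..k}. Transposition.transpose i j (\<beta> v)"
  show "finite {\<beta> \<in> distinct_tuples n k. \<beta> u = j}"
    using finite_distinct_tuples by simp
  show "inj_on ?T {\<beta> \<in> distinct_tuples n k. \<beta> u = i}"
  proof (rule inj_onI)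
    fix \<beta> \<gamma> assume \<beta>: "\<beta> \<in> {\<beta> \<in> distinct_tuples n k. \<beta> u = i}" and \<gamma>: "\<gamma> \<in> {\<beta> \<in> distinct_tuples n k. \<beta> u = i}"
      and eq: "?T \<beta> = ?T \<gamma>"
    have "\<beta> v = \<gamma> v" if "v \<in> {1..k}" for v
    proof -
      have "Transposition.transpose i j (\<beta> v) = Transposition.transpose i j (\<gamma> v)"
        using fun_cong[OF eq, of v] that by (simp only: restrict_apply' if_True)
      then show ?thesis using inj_transpose[of i j] by (rule injD[rotated])
    qed
    then show "\<beta> = \<gamma>"
      using \<beta> \<gamma> by (intro PiE_ext[of \<beta> "{1..k}" "\<lambda>_. {1..n}"]) (simp_all add: distinct_tuples_def)
  qed
  show "?T ` {\<beta> \<in> distinct_tuples n k. \<beta> u = i} \<subseteq> {\<beta> \<in> distinct_tuples n k. \<beta> u = j}"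
  proof (rule image_subsetI)
    fix \<beta> assume \<beta>: "\<beta> \<in> {\<beta> \<in> distinct_tuples n k. \<beta> u = i}"
    then have \<beta>': "\<beta> \<in> {1..k} \<rightarrow>\<^sub>E {1..n}" "inj_on \<beta> {1..k}" "\<beta> u = i"
      by (auto simp: distinct_tuples_def)
    have "Transposition.transpose i j (\<beta> v) \<in> {1..n}" if "v \<in> {1..k}" for v
      using PiE_mem[OF \<beta>'(1) that] assms by (simp add: Transposition.transpose_def)
    moreover have "inj_on (?T \<beta>) {1..k}"
      unfolding inj_on_restrict_eq
      using comp_inj_on[OF \<beta>'(2) inj_on_subset[OF inj_transpose subset_UNIV], of i j] by (simp add: comp_def)
    moreover have "?T \<beta> u = j"
      using assms(1) \<beta>'(3) by simp
    ultimately show "?T \<beta> \<in> {\<beta> \<in> distinct_tuples n k. \<beta> u = j}"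
      by (simp add: distinct_tuples_def restrict_PiE_iff)
  qed
qed

lemma card_distinct_tuples_fiber:
  assumes u: "u \<in> {1..k}" and i: "i \<in> {1..n}"
  shows "real (card {\<beta> \<in> distinct_tuples n k. \<beta> u = i}) = real (card (distinct_tuples n k)) / real n"
proof -
  let ?F = "\<lambda>i. {\<beta> \<in> distinct_tuples n k. \<beta> u = i}"
  have "distinct_tuples n k = (\<Union>j\<in>{1..n}. ?F j)"
    using distinct_tuples_range[OF _ u] by blast
  then have "card (distinct_tuples n k) = card (\<Union>j\<in>{1..n}. ?F j)"
    by simp
  also have "\<dots> = (\<Sum>j\<in>{1..n}. card (?F j))"
    using finite_distinct_tuples by (intro card_UN_disjoint) auto
  also have "\<dots> = (\<Sum>j\<in>{1..n}. card (?F i))"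
    using card_distinct_tuples_fiber_le[OF u] i by (intro sum.cong[OF refl] antisym) auto
  also have "\<dots> = n * card (?F i)" by simp
  finally show ?thesis using i by (simp add: field_simps)
qed

text \<open>Every index occupies every position in the same number of tuples. This is what collapses
  the projected part of the statistic to a sum of independent variables.\<close>

lemma sum_over_distinct_tuples:
  fixes \<phi> :: "nat \<Rightarrow> nat \<Rightarrow> real"
  shows "(\<Sum>\<beta>\<in>distinct_tuples n k. \<Sum>u=1..k. \<phi> u (\<beta> u))
    = real (card (distinct_tuples n k)) / real n * (\<Sum>i=1..n. \<Sum>u=1..k. \<phi> u i)"
proof -
  have "(\<Sum>\<beta>\<in>distinct_tuples n k. \<phi> u (\<beta> u)) = real (card (distinct_tuples n k)) / real n * (\<Sum>i=1..n. \<phi> u i)"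
    if u: "u \<in> {1..k}" for u
  proof -
    have "(\<Sum>\<beta>\<in>distinct_tuples n k. \<phi> u (\<beta> u))
        = (\<Sum>i\<in>{1..n}. \<Sum>\<beta>\<in>{\<beta> \<in> distinct_tuples n k. \<beta> u = i}. \<phi> u (\<beta> u))"
      using distinct_tuples_range[OF _ u]
      by (intro sum.group[symmetric] finite_distinct_tuples finite_atLeastAtMost image_subsetI)
    also have "\<dots> = (\<Sum>i\<in>{1..n}. real (card {\<beta> \<in> distinct_tuples n k. \<beta> u = i}) * \<phi> u i)"
      by (intro sum.cong[OF refl]) simp
    also have "\<dots> = (\<Sum>i\<in>{1..n}. real (card (distinct_tuples n k)) / real n * \<phi> u i)"
      using card_distinct_tuples_fiber[OF u] by (intro sum.cong[OF refl]) simp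
    finally show ?thesis by (simp only: sum_distrib_left)
  qed
  then have "(\<Sum>u=1..k. \<Sum>\<beta>\<in>distinct_tuples n k. \<phi> u (\<beta> u))
      = (\<Sum>u=1..k. real (card (distinct_tuples n k)) / real n * (\<Sum>i=1..n. \<phi> u i))"
    by (intro sum.cong[OF refl])
  then show ?thesis
    by (subst sum.swap) (simp only: sum_distrib_left[symmetric] sum.swap[of _ "{1..n}" "{1..k}"])
qed

lemma card_distinct_tuples_asymp:
  "(\<lambda>n. real (card (distinct_tuples n k)) / real n ^ k) \<longlonglongrightarrow> 1"
proof -
  have "(\<lambda>n. real (n - j) / real n) \<longlonglongrightarrow> 1" for j
  proof (rule Lim_transform_eventually)
    show "(\<lambda>n. 1 - real j * (1 / real n)) \<longlonglongrightarrow> 1"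
      using tendsto_diff[OF tendsto_const[of 1] tendsto_mult_left[OF lim_1_over_n, of "real j"]] by simp
    show "\<forall>\<^sub>F n in sequentially. 1 - real j * (1 / real n) = real (n - j) / real n"
      using eventually_gt_at_top[of j]
      by eventually_elim (simp add: of_nat_diff field_simps)
  qed
  then have "(\<lambda>n. \<Prod>j<k. real (n - j) / real n) \<longlonglongrightarrow> (\<Prod>j<k. 1)"
    by (intro tendsto_prod)
  then show ?thesis
    by (simp add: card_distinct_tuples prod_dividef)
qed

section \<open>Independence of the vertex and edge variables\<close>

lemma (in prob_space) indep_vars_reindex_inj:
  assumes inj: "inj_on \<beta> K" and indep: "indep_vars (\<lambda>_. N) X (\<beta> ` K)"
  shows "indep_vars (\<lambda>_. N) (\<lambda>u. X (\<beta> u)) K"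
  unfolding indep_vars_def2
proof (intro conjI ballI indep_setsI)
  let ?G = "\<lambda>i. {X i -` A \<inter> space M | A. A \<in> sets N}"
  have ind: "indep_sets ?G (\<beta> ` K)" and rv: "\<And>i. i \<in> \<beta> ` K \<Longrightarrow> random_variable N (X i)"
    using indep by (auto simp: indep_vars_def2)
  show "random_variable N (X (\<beta> u))" if "u \<in> K" for u
    using rv that by auto
  show "?G (\<beta> u) \<subseteq> events" if "u \<in> K" for u
    using measurable_sets[OF rv[of "\<beta> u"]] that by auto
  fix A J assume J: "J \<noteq> {}" "J \<subseteq> K" "finite J" "\<forall>j\<in>J. A j \<in> ?G (\<beta> j)"
  have inv: "inv_into K \<beta> (\<beta> j) = j" if "j \<in> J" for j
    using that J inj by (auto intro: inv_into_f_f)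
  have "prob (\<Inter>i\<in>\<beta> ` J. A (inv_into K \<beta> i)) = (\<Prod>i\<in>\<beta> ` J. prob (A (inv_into K \<beta> i)))"
    using J inv by (intro indep_setsD[OF ind]) auto
  then show "prob (\<Inter>j\<in>J. A j) = (\<Prod>j\<in>J. prob (A j))"
    using inv inj_on_subset[OF inj J(2)] by (simp add: prod.reindex)
qed

lemma Int_stable_preimages: "Int_stable {h -` A \<inter> S | A. A \<in> sets N}"
proof (rule Int_stableI)
  fix a b assume "a \<in> {h -` A \<inter> S | A. A \<in> sets N}" "b \<in> {h -` A \<inter> S | A. A \<in> sets N}"
  then obtain A B where AB: "A \<in> sets N" "B \<in> sets N" "a = h -` A \<inter> S" "b = h -` B \<inter> S"
    by blast
  then have "a \<inter> b = h -` (A \<inter> B) \<inter> S" by auto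
  with AB show "a \<inter> b \<in> {h -` A \<inter> S | A. A \<in> sets N}" by blast
qed

context generalized_U_statistic
begin

lemma measurable_X: "1 \<le> i \<Longrightarrow> X i \<in> P \<rightarrow>\<^sub>M \<mu>"
  using X_indep by (auto simp: indep_vars_def)

lemma measurable_Y: "e \<in> all_index_pairs \<Longrightarrow> Y (fst e) (snd e) \<in> P \<rightarrow>\<^sub>M \<QQ>"
  using Y_indep by (auto simp: indep_vars_def)

lemma prob_space_\<mu>: "prob_space \<mu>"
  using prob_space_distr[OF measurable_X[of 1]] X_distr[of 1] by simp

lemma prob_space_\<QQ>: "prob_space \<QQ>"
  using prob_space_distr[OF measurable_Y[of "(1, 2)"]] Y_distr[of 1 2]
  by (simp add: all_index_pairs_def)

section \<open>Sigma-algebras generated by sets of vertex and edge variables\<close>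

text \<open>The vertex and edge variables have different value types and cannot form a single family
  for \<open>indep_vars\<close>, but their events can. \<open>Inl\<close> names a vertex variable,
  \<open>Inr\<close> an edge variable.\<close>

definition var_events :: "nat + nat \<times> nat \<Rightarrow> 'w set set" where
  "var_events = case_sum (\<lambda>i. {X i -` A \<inter> space P | A. A \<in> sets \<mu>})
     (\<lambda>e. {Y (fst e) (snd e) -` A \<inter> space P | A. A \<in> sets \<QQ>})"

text \<open>Packing the generated sigma-algebra as a measure space lets dependence on the variables
  in \<open>V\<close> alone be written as measurability.\<close>

definition vars_algebra :: "(nat + nat \<times> nat) set \<Rightarrow> 'w measure" where
  "vars_algebra V = sigma (space P) (\<Union>i\<in>V. var_events i)"

abbreviation all_vars :: "(nat + nat \<times> nat) set" where
  "all_vars \<equiv> {1..} <+> all_index_pairs"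

lemma var_events_subset:
  assumes "i \<in> all_vars"
  shows "var_events i \<subseteq> events"
proof (cases i)
  case (Inl j)
  then show ?thesis
    using assms measurable_sets[OF measurable_X[of j]] by (auto simp: var_events_def)
next
  case (Inr e)
  then show ?thesis
    using assms measurable_sets[OF measurable_Y[of e]] by (auto simp: var_events_def)
qed

lemma var_events_Pow: "var_events i \<subseteq> Pow (space P)"
  by (cases i) (auto simp: var_events_def)

lemma space_vars_algebra [simp]: "space (vars_algebra V) = space P"
  by (simp add: vars_algebra_def space_measure_of_conv)

lemma sets_vars_algebra: "sets (vars_algebra V) = sigma_sets (space P) (\<Union>i\<in>V. var_events i)"
  unfolding vars_algebra_def using var_events_Pow by (intro sets_measure_of) blast

lemma sets_vars_algebra_subset: "V \<subseteq> all_vars \<Longrightarrow> sets (vars_algebra V) \<subseteq> events"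
  unfolding sets_vars_algebra by (intro sets.sigma_sets_subset UN_least var_events_subset) auto

lemma measurable_from_vars_algebra:
  "h \<in> vars_algebra V \<rightarrow>\<^sub>M N \<Longrightarrow> V \<subseteq> all_vars \<Longrightarrow> h \<in> P \<rightarrow>\<^sub>M N"
  using sets_vars_algebra_subset[of V] by (auto simp: measurable_def)

lemma measurable_vars_algebra_mono:
  assumes "h \<in> vars_algebra V \<rightarrow>\<^sub>M N" "V \<subseteq> V'"
  shows "h \<in> vars_algebra V' \<rightarrow>\<^sub>M N"
proof -
  have "sets (vars_algebra V) \<subseteq> sets (vars_algebra V')"
    unfolding sets_vars_algebra using assms(2) by (intro sigma_sets_mono') auto
  then show ?thesis
    using assms(1) unfolding measurable_def by auto
qed

lemma measurable_vars_algebra_X: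
  assumes "Inl i \<in> V" "1 \<le> i"
  shows "X i \<in> vars_algebra V \<rightarrow>\<^sub>M \<mu>"
proof (rule measurableI)
  show "X i \<omega> \<in> space \<mu>" if "\<omega> \<in> space (vars_algebra V)" for \<omega>
    using measurable_space[OF measurable_X[OF assms(2)]] that by simp
  show "X i -` A \<inter> space (vars_algebra V) \<in> sets (vars_algebra V)" if "A \<in> sets \<mu>" for A
    unfolding sets_vars_algebra space_vars_algebra using that assms
    by (intro sigma_sets.Basic) (force simp: var_events_def)
qed

lemma measurable_vars_algebra_Y:
  assumes "Inr e \<in> V" "e \<in> all_index_pairs"
  shows "Y (fst e) (snd e) \<in> vars_algebra V \<rightarrow>\<^sub>M \<QQ>"
proof (rule measurableI)
  show "Y (fst e) (snd e) \<omega> \<in> space \<QQ>" if "\<omega> \<in> space (vars_algebra V)" for \<omega>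
    using measurable_space[OF measurable_Y[OF assms(2)]] that by simp
  show "Y (fst e) (snd e) -` A \<inter> space (vars_algebra V) \<in> sets (vars_algebra V)" if "A \<in> sets \<QQ>" for A
    unfolding sets_vars_algebra space_vars_algebra using that assms
    by (intro sigma_sets.Basic) (force simp: var_events_def)
qed

text \<open>A finite intersection splits into a vertex part and an edge part:
  \<open>X_Y_indep\<close> separates the two, and the independence inside each family factors each
  part.\<close>

lemma indep_sets_var_events: "indep_sets var_events all_vars"
proof (rule indep_setsI)
  show "var_events i \<subseteq> events" if "i \<in> all_vars" for i
    using that by (rule var_events_subset)
  fix A J assume J: "J \<noteq> {}" "J \<subseteq> all_vars" "finite J" "\<forall>j\<in>J. A j \<in> var_events j"
  define JX JY where "JX = Inl -` J" and "JY = Inr -` J"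
  have J_eq: "J = Inl ` JX \<union> Inr ` JY"
  proof (rule set_eqI)
    show "j \<in> J \<longleftrightarrow> j \<in> Inl ` JX \<union> Inr ` JY" for j
      by (cases j) (auto simp: JX_def JY_def)
  qed
  have fin: "finite JX" "finite JY"
    using J(3) by (auto simp: JX_def JY_def intro!: finite_vimageI)
  have JX: "JX \<subseteq> {1..}" and JY: "JY \<subseteq> all_index_pairs"
    using J(2) by (auto simp: JX_def JY_def)
  have "\<forall>i\<in>JX. \<exists>B. B \<in> sets \<mu> \<and> A (Inl i) = X i -` B \<inter> space P"
  proof
    fix i assume "i \<in> JX"
    then have "A (Inl i) \<in> var_events (Inl i)" using J(4) by (auto simp: JX_def)
    then show "\<exists>B. B \<in> sets \<mu> \<and> A (Inl i) = X i -` B \<inter> space P" by (auto simp: var_events_def)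
  qed
  then obtain B where B: "\<And>i. i \<in> JX \<Longrightarrow> B i \<in> sets \<mu>" "\<And>i. i \<in> JX \<Longrightarrow> A (Inl i) = X i -` B i \<inter> space P"
    by metis
  have "\<forall>e\<in>JY. \<exists>B. B \<in> sets \<QQ> \<and> A (Inr e) = Y (fst e) (snd e) -` B \<inter> space P"
  proof
    fix e assume "e \<in> JY"
    then have "A (Inr e) \<in> var_events (Inr e)" using J(4) by (auto simp: JY_def)
    then show "\<exists>B. B \<in> sets \<QQ> \<and> A (Inr e) = Y (fst e) (snd e) -` B \<inter> space P"
      by (auto simp: var_events_def)
  qed
  then obtain D where D: "\<And>e. e \<in> JY \<Longrightarrow> D e \<in> sets \<QQ>"
      "\<And>e. e \<in> JY \<Longrightarrow> A (Inr e) = Y (fst e) (snd e) -` D e \<inter> space P"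
    by metis
  \<comment> \<open>The condition \<open>\<omega> \<in> space P\<close> makes an empty part the
    whole space, whose probability 1 matches the empty product.\<close>
  define SX SY where "SX = {\<omega> \<in> space P. \<forall>i\<in>JX. \<omega> \<in> A (Inl i)}" and "SY = {\<omega> \<in> space P. \<forall>e\<in>JY. \<omega> \<in> A (Inr e)}"
  have "(\<Inter>j\<in>J. A j) = SX \<inter> SY"
  proof -
    obtain j where "j \<in> J" using J(1) by blast
    then have "A j \<subseteq> space P" using J(4) var_events_Pow[of j] by blast
    with \<open>j \<in> J\<close> have "(\<Inter>j\<in>J. A j) = {\<omega> \<in> space P. \<forall>j\<in>J. \<omega> \<in> A j}" by blast
    also have "\<dots> = SX \<inter> SY"
      unfolding SX_def SY_def J_eq by blast
    finally show ?thesis .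
  qed
  moreover have "prob (SX \<inter> SY) = prob SX * prob SY"
  proof (rule indep_setD[OF X_Y_indep])
    have "SX = (\<lambda>\<omega>. \<lambda>i\<in>{1..}. X i \<omega>) -` {x \<in> space (\<Pi>\<^sub>M i\<in>{1..}. \<mu>). \<forall>i\<in>JX. x i \<in> B i} \<inter> space P"
    proof -
      have 1: "(\<lambda>i\<in>{1..}. X i \<omega>) \<in> space (\<Pi>\<^sub>M i\<in>{1..}. \<mu>)" if "\<omega> \<in> space P" for \<omega>
        using that measurable_space[OF measurable_X] by (simp add: space_PiM)
      have 2: "\<omega> \<in> A (Inl i) \<longleftrightarrow> (\<lambda>i\<in>{1..}. X i \<omega>) i \<in> B i" if "\<omega> \<in> space P" "i \<in> JX" for \<omega> i
        using that B(2) JX by auto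
      show ?thesis
        unfolding SX_def using 1 2 by blast
    qed
    moreover have "{x \<in> space (\<Pi>\<^sub>M i\<in>{1..}. \<mu>). \<forall>i\<in>JX. x i \<in> B i} \<in> sets (\<Pi>\<^sub>M i\<in>{1..}. \<mu>)"
    proof (rule sets.sets_Collect_finite_All[OF _ fin(1)])
      fix j assume j: "j \<in> JX"
      then have "(\<lambda>x. x j) \<in> (\<Pi>\<^sub>M i\<in>{1..}. \<mu>) \<rightarrow>\<^sub>M \<mu>"
        using JX by (intro measurable_component_singleton) auto
      from measurable_sets[OF this B(1)[OF j]]
      show "{x \<in> space (\<Pi>\<^sub>M i\<in>{1..}. \<mu>). x j \<in> B j} \<in> sets (\<Pi>\<^sub>M i\<in>{1..}. \<mu>)"
        by (simp add: vimage_def Int_def conj_commute)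
    qed
    ultimately show "SX \<in> {(\<lambda>\<omega>. \<lambda>i\<in>{1..}. X i \<omega>) -` A \<inter> space P | A. A \<in> sets (\<Pi>\<^sub>M i\<in>{1..}. \<mu>)}"
      by blast
    have "SY = (\<lambda>\<omega>. \<lambda>p\<in>all_index_pairs. Y (fst p) (snd p) \<omega>)
        -` {x \<in> space (\<Pi>\<^sub>M p\<in>all_index_pairs. \<QQ>). \<forall>e\<in>JY. x e \<in> D e} \<inter> space P"
    proof -
      have 1: "(\<lambda>p\<in>all_index_pairs. Y (fst p) (snd p) \<omega>) \<in> space (\<Pi>\<^sub>M p\<in>all_index_pairs. \<QQ>)"
        if "\<omega> \<in> space P" for \<omega>
        using that measurable_space[OF measurable_Y] by (simp add: space_PiM)
      have 2: "\<omega> \<in> A (Inr e) \<longleftrightarrow> (\<lambda>p\<in>all_index_pairs. Y (fst p) (snd p) \<omega>) e \<in> D e"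
        if "\<omega> \<in> space P" "e \<in> JY" for \<omega> e
        using that D(2) JY by auto
      show ?thesis
        unfolding SY_def using 1 2 by blast
    qed
    moreover have "{x \<in> space (\<Pi>\<^sub>M p\<in>all_index_pairs. \<QQ>). \<forall>e\<in>JY. x e \<in> D e} \<in> sets (\<Pi>\<^sub>M p\<in>all_index_pairs. \<QQ>)"
    proof (rule sets.sets_Collect_finite_All[OF _ fin(2)])
      fix j assume j: "j \<in> JY"
      then have "(\<lambda>x. x j) \<in> (\<Pi>\<^sub>M i\<in>all_index_pairs. \<QQ>) \<rightarrow>\<^sub>M \<QQ>"
        using JY by (intro measurable_component_singleton) auto
      from measurable_sets[OF this D(1)[OF j]]
      show "{x \<in> space (\<Pi>\<^sub>M i\<in>all_index_pairs. \<QQ>). x j \<in> D j} \<in> sets (\<Pi>\<^sub>M i\<in>all_index_pairs. \<QQ>)"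
        by (simp add: vimage_def Int_def conj_commute)
    qed
    ultimately show "SY \<in> {(\<lambda>\<omega>. \<lambda>p\<in>all_index_pairs. Y (fst p) (snd p) \<omega>) -` A \<inter> space P | A.
          A \<in> sets (\<Pi>\<^sub>M p\<in>all_index_pairs. \<QQ>)}"
      by blast
  qed
  moreover have "prob SX = (\<Prod>i\<in>JX. prob (A (Inl i)))"
  proof (cases "JX = {}")
    case True
    then show ?thesis by (simp add: SX_def prob_space)
  next
    case False
    then have "SX = (\<Inter>i\<in>JX. A (Inl i))" using B(2) by (auto simp: SX_def)
    moreover have "prob (\<Inter>i\<in>JX. A (Inl i)) = (\<Prod>i\<in>JX. prob (A (Inl i)))"
      using X_indep JX False fin(1) B unfolding indep_vars_def2
      by (elim conjE) (rule indep_setsD, auto)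
    ultimately show ?thesis by simp
  qed
  moreover have "prob SY = (\<Prod>e\<in>JY. prob (A (Inr e)))"
  proof (cases "JY = {}")
    case True
    then show ?thesis by (simp add: SY_def prob_space)
  next
    case False
    then have "SY = (\<Inter>e\<in>JY. A (Inr e))" using D(2) by (auto simp: SY_def)
    moreover have "prob (\<Inter>e\<in>JY. A (Inr e)) = (\<Prod>e\<in>JY. prob (A (Inr e)))"
      using Y_indep JY False fin(2) D unfolding indep_vars_def2
      by (elim conjE) (rule indep_setsD, auto)
    ultimately show ?thesis by simp
  qed
  moreover have "(\<Prod>j\<in>J. prob (A j)) = (\<Prod>i\<in>JX. prob (A (Inl i))) * (\<Prod>e\<in>JY. prob (A (Inr e)))"
    unfolding J_eq using fin by (subst prod.union_disjoint) (auto simp: prod.reindex)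
  ultimately show "prob (\<Inter>j\<in>J. A j) = (\<Prod>j\<in>J. prob (A j))" by simp
qed

text \<open>The events of a single variable are stable under intersection, so disjoint sets of
  variables generate independent sigma-algebras. This reduces the factorization of expectations to
  the disjointness of sets of variables.\<close>

lemma distr_pair_vars_algebra:
  assumes V: "V \<subseteq> all_vars" "V' \<subseteq> all_vars" "V \<inter> V' = {}"
    and U: "U \<in> vars_algebra V \<rightarrow>\<^sub>M N" and W: "W \<in> vars_algebra V' \<rightarrow>\<^sub>M N'"
  shows "distr P (N \<Otimes>\<^sub>M N') (\<lambda>\<omega>. (U \<omega>, W \<omega>)) = distr P N U \<Otimes>\<^sub>M distr P N' W"
proof -
  have "indep_sets (\<lambda>b. sigma_sets (space P) (\<Union>i\<in>case_bool V V' b. var_events i)) UNIV"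
  proof (rule indep_sets_collect_sigma)
    show "indep_sets var_events (\<Union>b. case_bool V V' b)"
      using V by (intro indep_sets_mono_index[OF _ indep_sets_var_events]) (auto split: bool.splits)
    show "Int_stable (var_events i)" for i
      by (cases i) (simp_all add: var_events_def Int_stable_preimages)
    show "disjoint_family (case_bool V V')"
      using V by (auto simp: disjoint_family_on_def split: bool.splits)
  qed
  then have *: "indep_set (sets (vars_algebra V)) (sets (vars_algebra V'))"
    unfolding indep_set_def sets_vars_algebra
    by (rule back_subst[of "\<lambda>F. indep_sets F UNIV"]) (auto split: bool.splits)
  have [measurable]: "U \<in> P \<rightarrow>\<^sub>M N" "W \<in> P \<rightarrow>\<^sub>M N'"
    using measurable_from_vars_algebra U W V by auto
  interpret U: prob_space "distr P N U" by (rule prob_space_distr) measurable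
  interpret W: prob_space "distr P N' W" by (rule prob_space_distr) measurable
  show ?thesis
  proof (rule pair_measure_eqI[symmetric])
    fix A B assume "A \<in> sets (distr P N U)" "B \<in> sets (distr P N' W)"
    then have [measurable]: "A \<in> sets N" "B \<in> sets N'" by auto
    have "U -` A \<inter> space P \<in> sets (vars_algebra V)" "W -` B \<inter> space P \<in> sets (vars_algebra V')"
      using measurable_sets[OF U, of A] measurable_sets[OF W, of B] by auto
    then have "prob ((U -` A \<inter> space P) \<inter> (W -` B \<inter> space P)) = prob (U -` A \<inter> space P) * prob (W -` B \<inter> space P)"
      by (rule indep_setD[OF *])
    also have "(U -` A \<inter> space P) \<inter> (W -` B \<inter> space P) = (\<lambda>\<omega>. (U \<omega>, W \<omega>)) -` (A \<times> B) \<inter> space P"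
      by auto
    finally show "emeasure (distr P N U) A * emeasure (distr P N' W) B
        = emeasure (distr P (N \<Otimes>\<^sub>M N') (\<lambda>\<omega>. (U \<omega>, W \<omega>))) (A \<times> B)"
      by (simp add: emeasure_distr emeasure_eq_measure ennreal_mult)
  qed (auto intro: U.sigma_finite_measure_axioms W.sigma_finite_measure_axioms)
qed

end

section \<open>Moments of the degenerate part\<close>

locale bounded_kernel = generalized_U_statistic P \<mu> \<QQ> X Y
  for P :: "'w measure" and \<mu> :: "'s measure" and \<QQ> :: "'m measure"
    and X :: "nat \<Rightarrow> 'w \<Rightarrow> 's" and Y :: "nat \<Rightarrow> nat \<Rightarrow> 'w \<Rightarrow> 'm" +
  fixes k :: nat and f :: "(nat \<Rightarrow> 's) \<times> (nat \<times> nat \<Rightarrow> 'm) \<Rightarrow> real" and C :: real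
  assumes k: "2 \<le> k"
    and f_measurable: "f \<in> borel_measurable (kernel_space \<mu> \<QQ> k)"
    and f_bound: "\<And>z. z \<in> space (kernel_space \<mu> \<QQ> k) \<Longrightarrow> \<bar>f z\<bar> \<le> C"
begin

section \<open>Samples along an index tuple and their law\<close>

text \<open>Unlike in \<open>distinct_tuples\<close>, the values are not bounded by some
  \<open>n\<close> and \<open>\<beta>\<close> is free outside \<open>{1..k}\<close>, so that
  \<open>id\<close> qualifies.\<close>

definition tuple :: "(nat \<Rightarrow> nat) \<Rightarrow> bool" where
  "tuple \<beta> \<longleftrightarrow> inj_on \<beta> {1..k} \<and> \<beta> ` {1..k} \<subseteq> {1..}"

text \<open>The independent family of edge variables is indexed by increasing pairs only, whereas
  \<open>\<beta>\<close> need not preserve the order of its arguments.\<close>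

definition edge :: "(nat \<Rightarrow> nat) \<Rightarrow> nat \<times> nat \<Rightarrow> nat \<times> nat" where
  "edge \<beta> p = (min (\<beta> (fst p)) (\<beta> (snd p)), max (\<beta> (fst p)) (\<beta> (snd p)))"

text \<open>For \<open>K = {1..k}\<close> this is \<open>kernel_space\<close>; for
  \<open>K = {1..k} - {l}\<close> it is the space over which \<open>kernel_marginal\<close>
  integrates.\<close>

definition partial_space :: "nat set \<Rightarrow> ((nat \<Rightarrow> 's) \<times> (nat \<times> nat \<Rightarrow> 'm)) measure" where
  "partial_space K = (\<Pi>\<^sub>M u\<in>K. \<mu>) \<Otimes>\<^sub>M (\<Pi>\<^sub>M p\<in>index_pairs k. \<QQ>)"

definition sample :: "nat set \<Rightarrow> (nat \<Rightarrow> nat) \<Rightarrow> 'w \<Rightarrow> (nat \<Rightarrow> 's) \<times> (nat \<times> nat \<Rightarrow> 'm)" where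
  "sample K \<beta> \<omega> = (\<lambda>u\<in>K. X (\<beta> u) \<omega>, \<lambda>p\<in>index_pairs k. Y (\<beta> (fst p)) (\<beta> (snd p)) \<omega>)"

text \<open>All edges are listed whatever \<open>K\<close> is: omitting a vertex from the sample
  keeps the edge variables incident to it.\<close>

definition tuple_vars :: "nat set \<Rightarrow> (nat \<Rightarrow> nat) \<Rightarrow> (nat + nat \<times> nat) set" where
  "tuple_vars K \<beta> = \<beta> ` K <+> edge \<beta> ` index_pairs k"

lemma tuple_ge_1: "tuple \<beta> \<Longrightarrow> u \<in> {1..k} \<Longrightarrow> 1 \<le> \<beta> u"
  unfolding tuple_def atLeast_iff[symmetric, of "\<beta> u"] by blast

lemma edge_in_all_index_pairs:
  assumes "tuple \<beta>" "p \<in> index_pairs k"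
  shows "edge \<beta> p \<in> all_index_pairs"
proof -
  have "fst p \<in> {1..k}" "snd p \<in> {1..k}" "fst p \<noteq> snd p"
    using assms(2) by (auto simp: index_pairs_def)
  moreover from this have "\<beta> (fst p) \<noteq> \<beta> (snd p)" "1 \<le> \<beta> (fst p)" "1 \<le> \<beta> (snd p)"
    using assms(1) tuple_ge_1 by (auto simp: tuple_def dest: inj_onD)
  ultimately show ?thesis
    by (auto simp: edge_def all_index_pairs_def)
qed

text \<open>Two equal sorted pairs match either straight or crossed; a crossed match would reverse
  the order inside an index pair.\<close>

lemma inj_on_edge:
  assumes "tuple \<beta>"
  shows "inj_on (edge \<beta>) (index_pairs k)"
proof (rule inj_onI)
  fix p q assume p: "p \<in> index_pairs k" and q: "q \<in> index_pairs k" and eq: "edge \<beta> p = edge \<beta> q"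
  have pq: "fst p \<in> {1..k}" "snd p \<in> {1..k}" "fst p < snd p" "fst q \<in> {1..k}" "snd q \<in> {1..k}" "fst q < snd q"
    using p q by (auto simp: index_pairs_def)
  have eqD: "u = v" if "\<beta> u = \<beta> v" "u \<in> {1..k}" "v \<in> {1..k}" for u v
    using that assms unfolding tuple_def by (meson inj_onD)
  have "(\<beta> (fst p) = \<beta> (fst q) \<and> \<beta> (snd p) = \<beta> (snd q)) \<or> (\<beta> (fst p) = \<beta> (snd q) \<and> \<beta> (snd p) = \<beta> (fst q))"
    using eq by (auto simp: edge_def min_def max_def split: if_splits)
  then show "p = q"
  proof
    assume "\<beta> (fst p) = \<beta> (fst q) \<and> \<beta> (snd p) = \<beta> (snd q)"
    then show ?thesis using eqD pq by (auto intro: prod_eqI)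
  next
    assume "\<beta> (fst p) = \<beta> (snd q) \<and> \<beta> (snd p) = \<beta> (fst q)"
    then have "fst p = snd q" "snd p = fst q" using eqD pq by auto
    then show ?thesis using pq by simp
  qed
qed

lemma Y_edge:
  assumes "tuple \<beta>" "p \<in> index_pairs k"
  shows "Y (\<beta> (fst p)) (\<beta> (snd p)) = Y (fst (edge \<beta> p)) (snd (edge \<beta> p))"
  using edge_in_all_index_pairs[OF assms] Y_sym[of "\<beta> (snd p)" "\<beta> (fst p)"]
  by (auto simp: edge_def all_index_pairs_def min_def max_def split: if_splits)

lemma tuple_vars_subset: "tuple \<beta> \<Longrightarrow> K \<subseteq> {1..k} \<Longrightarrow> tuple_vars K \<beta> \<subseteq> all_vars"
  using edge_in_all_index_pairs tuple_ge_1 by (auto simp: tuple_vars_def)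

lemma measurable_sample:
  assumes \<beta>: "tuple \<beta>" and K: "K \<subseteq> {1..k}" and V: "tuple_vars K \<beta> \<subseteq> V"
  shows "sample K \<beta> \<in> vars_algebra V \<rightarrow>\<^sub>M partial_space K"
  unfolding sample_def[abs_def] partial_space_def
proof (intro measurable_Pair measurable_restrict)
  show "X (\<beta> u) \<in> vars_algebra V \<rightarrow>\<^sub>M \<mu>" if "u \<in> K" for u
    using that V K tuple_ge_1[OF \<beta>] by (intro measurable_vars_algebra_X) (auto simp: tuple_vars_def)
  show "Y (\<beta> (fst p)) (\<beta> (snd p)) \<in> vars_algebra V \<rightarrow>\<^sub>M \<QQ>" if "p \<in> index_pairs k" for p
    unfolding Y_edge[OF \<beta> that] using that V edge_in_all_index_pairs[OF \<beta> that]
    by (intro measurable_vars_algebra_Y) (auto simp: tuple_vars_def)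
qed

lemma index_pairs_nonempty: "index_pairs k \<noteq> {}"
proof -
  have "(1, 2) \<in> index_pairs k" using k by (simp add: index_pairs_def)
  then show ?thesis by blast
qed

lemma prob_space_partial_space: "prob_space (partial_space K)"
  unfolding partial_space_def
  using prob_space_\<mu> prob_space_\<QQ>
  by (intro prob_space_pair prob_space_PiM)

text \<open>The vertex block and the edge block are independent, and within each block distinct
  positions name distinct variables of the i.i.d. families. Hence the law is the same for all
  tuples, and samples can be integrated against a product measure.\<close>

lemma distr_sample:
  assumes \<beta>: "tuple \<beta>" and K: "K \<subseteq> {1..k}" "K \<noteq> {}"
  shows "distr P (partial_space K) (sample K \<beta>) = partial_space K"
proof -
  let ?X = "\<lambda>\<omega>. \<lambda>u\<in>K. X (\<beta> u) \<omega>" and ?Y = "\<lambda>\<omega>. \<lambda>p\<in>index_pairs k. Y (\<beta> (fst p)) (\<beta> (snd p)) \<omega>"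
  let ?VX = "Inl ` \<beta> ` K :: (nat + nat \<times> nat) set" and ?VY = "Inr ` edge \<beta> ` index_pairs k :: (nat + nat \<times> nat) set"
  have "distr P ((\<Pi>\<^sub>M u\<in>K. \<mu>) \<Otimes>\<^sub>M (\<Pi>\<^sub>M p\<in>index_pairs k. \<QQ>)) (\<lambda>\<omega>. (?X \<omega>, ?Y \<omega>))
      = distr P (\<Pi>\<^sub>M u\<in>K. \<mu>) ?X \<Otimes>\<^sub>M distr P (\<Pi>\<^sub>M p\<in>index_pairs k. \<QQ>) ?Y"
  proof (rule distr_pair_vars_algebra)
    show "?VX \<subseteq> all_vars" "?VY \<subseteq> all_vars" "?VX \<inter> ?VY = {}"
      using tuple_vars_subset[OF \<beta> K(1)] by (auto simp: tuple_vars_def)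
    show "?X \<in> vars_algebra ?VX \<rightarrow>\<^sub>M (\<Pi>\<^sub>M u\<in>K. \<mu>)"
      using K tuple_ge_1[OF \<beta>] by (intro measurable_restrict measurable_vars_algebra_X) auto
    show "?Y \<in> vars_algebra ?VY \<rightarrow>\<^sub>M (\<Pi>\<^sub>M p\<in>index_pairs k. \<QQ>)"
    proof (rule measurable_restrict)
      show "Y (\<beta> (fst p)) (\<beta> (snd p)) \<in> vars_algebra ?VY \<rightarrow>\<^sub>M \<QQ>" if "p \<in> index_pairs k" for p
        unfolding Y_edge[OF \<beta> that] using that edge_in_all_index_pairs[OF \<beta> that]
        by (intro measurable_vars_algebra_Y) auto
    qed
  qed
  then have "distr P (partial_space K) (sample K \<beta>) = distr P (\<Pi>\<^sub>M u\<in>K. \<mu>) ?X \<Otimes>\<^sub>M distr P (\<Pi>\<^sub>M p\<in>index_pairs k. \<QQ>) ?Y"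
    by (simp add: partial_space_def sample_def[abs_def])
  also have "distr P (\<Pi>\<^sub>M u\<in>K. \<mu>) ?X = (\<Pi>\<^sub>M u\<in>K. \<mu>)"
  proof -
    have K1: "\<beta> ` K \<subseteq> {1..}" "inj_on \<beta> K"
      using K \<beta> by (auto simp: tuple_def intro: inj_on_subset)
    have "indep_vars (\<lambda>_. \<mu>) (\<lambda>u. X (\<beta> u)) K"
      by (rule indep_vars_reindex_inj[OF K1(2) indep_vars_subset[OF X_indep K1(1)]])
    then have "distr P (\<Pi>\<^sub>M u\<in>K. \<mu>) ?X = (\<Pi>\<^sub>M u\<in>K. distr P \<mu> (X (\<beta> u)))"
      using K1 measurable_X by (subst (asm) indep_vars_iff_distr_eq_PiM') (auto simp: K)
    also have "\<dots> = (\<Pi>\<^sub>M u\<in>K. \<mu>)"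
      using K1 X_distr by (intro PiM_cong) auto
    finally show ?thesis .
  qed
  also have "distr P (\<Pi>\<^sub>M p\<in>index_pairs k. \<QQ>) ?Y = (\<Pi>\<^sub>M p\<in>index_pairs k. \<QQ>)"
  proof -
    have E: "edge \<beta> ` index_pairs k \<subseteq> all_index_pairs"
      using edge_in_all_index_pairs[OF \<beta>] by auto
    have "indep_vars (\<lambda>_. \<QQ>) (\<lambda>p. Y (fst (edge \<beta> p)) (snd (edge \<beta> p))) (index_pairs k)"
      using indep_vars_reindex_inj[OF inj_on_edge[OF \<beta>] indep_vars_subset[OF Y_indep E]] .
    then have "distr P (\<Pi>\<^sub>M p\<in>index_pairs k. \<QQ>) (\<lambda>\<omega>. \<lambda>p\<in>index_pairs k. Y (fst (edge \<beta> p)) (snd (edge \<beta> p)) \<omega>)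
        = (\<Pi>\<^sub>M p\<in>index_pairs k. distr P \<QQ> (Y (fst (edge \<beta> p)) (snd (edge \<beta> p))))"
      using E measurable_Y by (subst (asm) indep_vars_iff_distr_eq_PiM') (auto simp: index_pairs_nonempty)
    also have "\<dots> = (\<Pi>\<^sub>M p\<in>index_pairs k. \<QQ>)"
      using E Y_distr by (intro PiM_cong) (auto simp: all_index_pairs_def)
    also have "(\<lambda>\<omega>. \<lambda>p\<in>index_pairs k. Y (fst (edge \<beta> p)) (snd (edge \<beta> p)) \<omega>) = ?Y"
      by (intro ext) (simp add: restrict_def Y_edge[OF \<beta>])
    finally show ?thesis .
  qed
  finally show ?thesis by (simp add: partial_space_def)
qed

section \<open>One-variable marginals of the kernel\<close>

abbreviation marginal :: "nat \<Rightarrow> 's \<Rightarrow> real" where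
  "marginal l \<equiv> kernel_marginal \<mu> \<QQ> k f l"

lemma marginal_eq: "marginal l x = (\<integral>z. f ((fst z)(l := x), snd z) \<partial>partial_space ({1..k} - {l}))"
  by (simp add: kernel_marginal_def partial_space_def)

lemma measurable_insert_coordinate:
  assumes "l \<in> {1..k}"
  shows "(\<lambda>(x, z). ((fst z)(l := x), snd z)) \<in> \<mu> \<Otimes>\<^sub>M partial_space ({1..k} - {l}) \<rightarrow>\<^sub>M kernel_space \<mu> \<QQ> k"
  unfolding kernel_space_def partial_space_def split_beta
  by (intro measurable_Pair measurable_fun_upd[where J = "{1..k} - {l}"]) (use assms in auto)

lemma measurable_marginal [measurable]:
  assumes "l \<in> {1..k}"
  shows "marginal l \<in> borel_measurable \<mu>"
proof -
  interpret K: prob_space "partial_space ({1..k} - {l})"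
    by (rule prob_space_partial_space)
  have "(\<lambda>(x, z). f ((fst z)(l := x), snd z)) \<in> borel_measurable (\<mu> \<Otimes>\<^sub>M partial_space ({1..k} - {l}))"
    using measurable_compose[OF measurable_insert_coordinate[OF assms] f_measurable]
    by (simp add: split_beta)
  then show ?thesis
    unfolding marginal_eq[abs_def] by (rule K.borel_measurable_lebesgue_integral)
qed

lemma insert_coordinate_in_space:
  assumes "l \<in> {1..k}" "x \<in> space \<mu>" "z \<in> space (partial_space ({1..k} - {l}))"
  shows "((fst z)(l := x), snd z) \<in> space (kernel_space \<mu> \<QQ> k)"
  using measurable_space[OF measurable_insert_coordinate[OF assms(1)], of "(x, z)"] assms
  by (simp add: space_pair_measure)

lemma C_nonneg: "0 \<le> C"
proof -
  interpret K: prob_space "kernel_space \<mu> \<QQ> k"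
    using prob_space_partial_space[of "{1..k}"] by (simp add: partial_space_def kernel_space_def)
  obtain z where "z \<in> space (kernel_space \<mu> \<QQ> k)" using K.not_empty by blast
  then show ?thesis using f_bound[of z] by linarith
qed

lemma marginal_bound:
  assumes "l \<in> {1..k}" "x \<in> space \<mu>"
  shows "\<bar>marginal l x\<bar> \<le> C"
proof -
  interpret K: prob_space "partial_space ({1..k} - {l})"
    by (rule prob_space_partial_space)
  let ?g = "\<lambda>z. f ((fst z)(l := x), snd z)"
  have bd: "\<bar>?g z\<bar> \<le> C" if "z \<in> space (partial_space ({1..k} - {l}))" for z
    using f_bound insert_coordinate_in_space[OF assms that] by blast
  have "\<bar>marginal l x\<bar> \<le> (\<integral>z. \<bar>?g z\<bar> \<partial>partial_space ({1..k} - {l}))"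
    unfolding marginal_eq by (rule integral_abs_bound)
  also have "\<dots> \<le> (\<integral>z. C \<partial>partial_space ({1..k} - {l}))"
    using bd C_nonneg by (intro integral_mono' K.integrable_const) auto
  finally show ?thesis using K.prob_space by simp
qed

text \<open>Conditionally on the variable at position \<open>l\<close> and on \<open>G\<close>, the remaining variables of the
  sample are fresh, so they are integrated out.\<close>
lemma expectation_kernel_mult:
  assumes \<beta>: "tuple \<beta>" and l: "l \<in> {1..k}"
    and V: "V \<subseteq> all_vars" "V \<inter> tuple_vars ({1..k} - {l}) \<beta> = {}"
    and G: "G \<in> borel_measurable (vars_algebra V)" "\<And>\<omega>. \<omega> \<in> space P \<Longrightarrow> \<bar>G \<omega>\<bar> \<le> B"
  shows "expectation (\<lambda>\<omega>. f (sample {1..k} \<beta> \<omega>) * G \<omega>) = expectation (\<lambda>\<omega>. marginal l (X (\<beta> l) \<omega>) * G \<omega>)"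
proof -
  let ?K = "{1..k} - {l}"
  \<comment> \<open>\<open>V\<close> may already contain the vertex \<open>\<beta> l\<close>.
    Adjoining it makes the pair \<open>?W\<close> measurable, and the set stays disjoint from the
    remaining variables of the sample because \<open>\<beta>\<close> is injective.\<close>
  let ?V = "insert (Inl (\<beta> l)) V"
  let ?W = "\<lambda>\<omega>. (X (\<beta> l) \<omega>, G \<omega>)"
  let ?N = "\<mu> \<Otimes>\<^sub>M (borel :: real measure)"
  let ?F = "\<lambda>(w, z). f ((fst z)(l := fst w), snd z) * snd w"
  have \<beta>l: "1 \<le> \<beta> l" using tuple_ge_1[OF \<beta> l] .
  have K: "?K \<subseteq> {1..k}" "?K \<noteq> {}"
  proof -
    \<comment> \<open>\<open>distr_sample\<close> asks for a nonempty set of positions;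
      \<open>2 \<le> k\<close> leaves one besides \<open>l\<close>.\<close>
    have "(if l = 1 then 2 else 1) \<in> ?K" using k by auto
    then show "?K \<noteq> {}" by blast
  qed auto
  have V': "?V \<subseteq> all_vars" "?V \<inter> tuple_vars ?K \<beta> = {}"
  proof -
    show "?V \<subseteq> all_vars" using V \<beta>l by auto
    have "\<beta> l \<notin> \<beta> ` ?K"
      using \<beta> l by (auto simp: tuple_def dest: inj_onD)
    then show "?V \<inter> tuple_vars ?K \<beta> = {}"
      using V by (auto simp: tuple_vars_def)
  qed
  have W: "?W \<in> vars_algebra ?V \<rightarrow>\<^sub>M ?N"
    using \<beta>l by (intro measurable_Pair measurable_vars_algebra_X measurable_vars_algebra_mono[OF G(1)]) auto
  have U: "sample ?K \<beta> \<in> vars_algebra (tuple_vars ?K \<beta>) \<rightarrow>\<^sub>M partial_space ?K"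
    by (rule measurable_sample[OF \<beta> K(1)]) simp
  have WP: "?W \<in> P \<rightarrow>\<^sub>M ?N" and UP: "sample ?K \<beta> \<in> P \<rightarrow>\<^sub>M partial_space ?K"
    using measurable_from_vars_algebra[OF W V'(1)]
      measurable_from_vars_algebra[OF U tuple_vars_subset[OF \<beta> K(1)]] by auto
  have joint: "distr P ?N ?W \<Otimes>\<^sub>M partial_space ?K = distr P (?N \<Otimes>\<^sub>M partial_space ?K) (\<lambda>\<omega>. (?W \<omega>, sample ?K \<beta> \<omega>))"
    using distr_pair_vars_algebra[OF V'(1) tuple_vars_subset[OF \<beta> K(1)] V'(2) W U]
    unfolding distr_sample[OF \<beta> K] by simp
  interpret K: prob_space "partial_space ?K"
    by (rule prob_space_partial_space)
  interpret N: prob_space "distr P ?N ?W"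
    by (rule prob_space_distr[OF WP])
  interpret NK: pair_sigma_finite "distr P ?N ?W" "partial_space ?K" ..
  have Fm: "?F \<in> borel_measurable (?N \<Otimes>\<^sub>M partial_space ?K)"
  proof -
    have "(\<lambda>q. (fst (fst q), snd q)) \<in> ?N \<Otimes>\<^sub>M partial_space ?K \<rightarrow>\<^sub>M \<mu> \<Otimes>\<^sub>M partial_space ?K"
      by measurable
    from measurable_compose[OF this measurable_compose[OF measurable_insert_coordinate[OF l] f_measurable]]
    have [measurable]: "(\<lambda>q. f ((fst (snd q))(l := fst (fst q)), snd (snd q))) \<in> borel_measurable (?N \<Otimes>\<^sub>M partial_space ?K)"
      by (simp add: split_beta)
    show ?thesis unfolding split_beta by measurable
  qed
  have FP: "?F (?W \<omega>, sample ?K \<beta> \<omega>) = f (sample {1..k} \<beta> \<omega>) * G \<omega>" for \<omega>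
  proof -
    have "(\<lambda>u\<in>?K. X (\<beta> u) \<omega>)(l := X (\<beta> l) \<omega>) = (\<lambda>u\<in>{1..k}. X (\<beta> u) \<omega>)"
      using l by (auto simp: fun_eq_iff)
    then show ?thesis by (simp add: sample_def)
  qed
  have WUP: "(\<lambda>\<omega>. (?W \<omega>, sample ?K \<beta> \<omega>)) \<in> P \<rightarrow>\<^sub>M ?N \<Otimes>\<^sub>M partial_space ?K"
    using WP UP by (rule measurable_Pair)
  have int: "integrable (distr P ?N ?W \<Otimes>\<^sub>M partial_space ?K) ?F"
    unfolding joint
  proof (subst integrable_distr_eq[OF WUP Fm], rule integrable_const_bound[of _ "C * B"])
    show "AE \<omega> in P. norm (?F (?W \<omega>, sample ?K \<beta> \<omega>)) \<le> C * B"
    proof (rule AE_I2)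
      fix \<omega> assume \<omega>: "\<omega> \<in> space P"
      have "sample {1..k} \<beta> \<omega> \<in> space (kernel_space \<mu> \<QQ> k)"
        using measurable_space[OF measurable_sample[OF \<beta>, of "{1..k}" UNIV], of \<omega>] \<omega>
        by (simp add: partial_space_def kernel_space_def)
      then show "norm (?F (?W \<omega>, sample ?K \<beta> \<omega>)) \<le> C * B"
        unfolding FP using f_bound[of "sample {1..k} \<beta> \<omega>"] G(2)[OF \<omega>] C_nonneg
        by (simp add: abs_mult mult_mono)
    qed
    show "(\<lambda>\<omega>. ?F (?W \<omega>, sample ?K \<beta> \<omega>)) \<in> borel_measurable P"
      by (rule measurable_compose[OF WUP Fm])
  qed
  have "expectation (\<lambda>\<omega>. f (sample {1..k} \<beta> \<omega>) * G \<omega>) = integral\<^sup>L (distr P ?N ?W \<Otimes>\<^sub>M partial_space ?K) ?F"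
    unfolding joint by (subst integral_distr[OF WUP Fm]) (simp only: FP)
  also have "\<dots> = (\<integral>w. (\<integral>z. ?F (w, z) \<partial>partial_space ?K) \<partial>distr P ?N ?W)"
    by (rule NK.integral_fst'[OF int, symmetric])
  also have "\<dots> = (\<integral>w. marginal l (fst w) * snd w \<partial>distr P ?N ?W)"
    by (simp add: marginal_eq)
  also have "\<dots> = expectation (\<lambda>\<omega>. marginal l (X (\<beta> l) \<omega>) * G \<omega>)"
    using measurable_marginal[OF l] by (subst integral_distr[OF WP]) auto
  finally show ?thesis .
qed

section \<open>Hoeffding projection of a single kernel term\<close>

text \<open>By \<open>expectation_kernel_sample\<close> all tuples give the same mean;
  \<open>id\<close> is a convenient representative.\<close>

definition mean_f :: real where
  "mean_f = expectation (\<lambda>\<omega>. f (sample {1..k} id \<omega>))"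

text \<open>Hoeffding's projection: conditionally on any single \<open>X (\<beta> u)\<close> this has mean zero.\<close>
definition degen :: "(nat \<Rightarrow> nat) \<Rightarrow> 'w \<Rightarrow> real" where
  "degen \<beta> \<omega> = f (sample {1..k} \<beta> \<omega>) - mean_f - (\<Sum>u=1..k. marginal u (X (\<beta> u) \<omega>) - mean_f)"

lemma integrable_bounded:
  "h \<in> borel_measurable P \<Longrightarrow> (\<And>\<omega>. \<omega> \<in> space P \<Longrightarrow> \<bar>h \<omega> :: real\<bar> \<le> B) \<Longrightarrow> integrable P h"
  by (intro integrable_const_bound[of _ B]) auto

lemma measurable_kernel_sample:
  assumes "tuple \<beta>" "tuple_vars {1..k} \<beta> \<subseteq> V"
  shows "(\<lambda>\<omega>. f (sample {1..k} \<beta> \<omega>)) \<in> borel_measurable (vars_algebra V)"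
  using measurable_compose[OF measurable_sample[OF assms(1) subset_refl assms(2)]] f_measurable
  by (simp add: partial_space_def kernel_space_def)

lemma kernel_sample_bound:
  assumes "tuple \<beta>" "\<omega> \<in> space P"
  shows "\<bar>f (sample {1..k} \<beta> \<omega>)\<bar> \<le> C"
  using measurable_space[OF measurable_sample[OF assms(1), of "{1..k}" UNIV], of \<omega>] assms(2)
  by (intro f_bound) (simp add: partial_space_def kernel_space_def)

lemma measurable_marginal_X:
  assumes "l \<in> {1..k}" "1 \<le> i"
  shows "(\<lambda>\<omega>. marginal l (X i \<omega>)) \<in> borel_measurable (vars_algebra {Inl i})"
  using measurable_compose[OF measurable_vars_algebra_X measurable_marginal] assms by simp

lemma marginal_X_bound: "l \<in> {1..k} \<Longrightarrow> 1 \<le> i \<Longrightarrow> \<omega> \<in> space P \<Longrightarrow> \<bar>marginal l (X i \<omega>)\<bar> \<le> C"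
  using marginal_bound measurable_space[OF measurable_X] by blast

lemma integrable_kernel_sample: "tuple \<beta> \<Longrightarrow> integrable P (\<lambda>\<omega>. f (sample {1..k} \<beta> \<omega>))"
  using measurable_from_vars_algebra[OF measurable_kernel_sample tuple_vars_subset] kernel_sample_bound
  by (intro integrable_bounded[of _ C]) auto

lemma integrable_marginal_X: "l \<in> {1..k} \<Longrightarrow> 1 \<le> i \<Longrightarrow> integrable P (\<lambda>\<omega>. marginal l (X i \<omega>))"
  using measurable_from_vars_algebra[OF measurable_marginal_X] marginal_X_bound
  by (intro integrable_bounded[of _ C]) auto

lemma tuple_id: "tuple id"
  by (simp add: tuple_def)

lemma expectation_X: "1 \<le> i \<Longrightarrow> h \<in> borel_measurable \<mu> \<Longrightarrow> expectation (\<lambda>\<omega>. h (X i \<omega>)) = (\<integral>x. (h x :: real) \<partial>\<mu>)"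
  using integral_distr[OF measurable_X, of i h] X_distr[of i] by simp

text \<open>The case \<open>V = {}\<close> and \<open>G = 1\<close> of
  \<open>expectation_kernel_mult\<close>. One side is free of \<open>l\<close> and the other of
  \<open>\<beta>\<close>, so all samples and all marginals share a single mean.\<close>

lemma expectation_kernel_sample:
  assumes "tuple \<beta>" "l \<in> {1..k}"
  shows "expectation (\<lambda>\<omega>. f (sample {1..k} \<beta> \<omega>)) = (\<integral>x. marginal l x \<partial>\<mu>)"
  using expectation_kernel_mult[OF assms, of "{}" "\<lambda>_. 1" 1]
    expectation_X[OF tuple_ge_1[OF assms] measurable_marginal[OF assms(2)]]
  by simp

lemma expectation_marginal_X:
  assumes "l \<in> {1..k}" "1 \<le> i"
  shows "expectation (\<lambda>\<omega>. marginal l (X i \<omega>)) = mean_f"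
  using expectation_X[OF assms(2) measurable_marginal[OF assms(1)]] expectation_kernel_sample[OF tuple_id assms(1)]
  by (simp add: mean_f_def)

lemma expectation_marginal_mult:
  assumes u: "u \<in> {1..k}" "1 \<le> i" and V: "V \<subseteq> all_vars" "Inl i \<notin> V"
    and G: "G \<in> borel_measurable (vars_algebra V)" "\<And>\<omega>. \<omega> \<in> space P \<Longrightarrow> \<bar>G \<omega>\<bar> \<le> B"
  shows "expectation (\<lambda>\<omega>. marginal u (X i \<omega>) * G \<omega>) = mean_f * expectation G"
proof -
  have sub: "{Inl i} \<subseteq> all_vars" "{Inl i} \<inter> V = {}" using u V by auto
  have GP: "G \<in> borel_measurable P"
    by (rule measurable_from_vars_algebra[OF G(1) V(1)])
  have "indep_var borel (\<lambda>\<omega>. marginal u (X i \<omega>)) borel G"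
    unfolding indep_var_distribution_eq
    using distr_pair_vars_algebra[OF sub(1) V(1) sub(2) measurable_marginal_X[OF u] G(1)] GP
      measurable_from_vars_algebra[OF measurable_marginal_X[OF u] sub(1)]
    by simp
  then have "expectation (\<lambda>\<omega>. marginal u (X i \<omega>) * G \<omega>) = expectation (\<lambda>\<omega>. marginal u (X i \<omega>)) * expectation G"
    using integrable_marginal_X[OF u] integrable_bounded[OF GP G(2)]
    by (rule indep_var_lebesgue_integral)
  then show ?thesis
    by (simp add: expectation_marginal_X[OF u])
qed

lemma measurable_degen:
  assumes \<beta>: "tuple \<beta>" and V: "tuple_vars {1..k} \<beta> \<subseteq> V"
  shows "degen \<beta> \<in> borel_measurable (vars_algebra V)"
  unfolding degen_def[abs_def]
proof (intro borel_measurable_diff borel_measurable_sum borel_measurable_const measurable_kernel_sample[OF assms])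
  fix u assume u: "u \<in> {1..k}"
  have "{Inl (\<beta> u)} \<subseteq> V" using u V unfolding tuple_vars_def by blast
  then show "(\<lambda>\<omega>. marginal u (X (\<beta> u) \<omega>)) \<in> borel_measurable (vars_algebra V)"
    by (rule measurable_vars_algebra_mono[OF measurable_marginal_X[OF u tuple_ge_1[OF \<beta> u]]])
qed

lemma measurable_degen_P: "tuple \<beta> \<Longrightarrow> degen \<beta> \<in> borel_measurable P"
  using measurable_from_vars_algebra[OF measurable_degen tuple_vars_subset] by auto

lemma mean_f_bound: "\<bar>mean_f\<bar> \<le> C"
proof -
  have "\<bar>mean_f\<bar> \<le> expectation (\<lambda>\<omega>. \<bar>f (sample {1..k} id \<omega>)\<bar>)"
    unfolding mean_f_def by (rule integral_abs_bound)
  also have "\<dots> \<le> expectation (\<lambda>\<omega>. C)"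
    using kernel_sample_bound[OF tuple_id] integrable_kernel_sample[OF tuple_id]
    by (intro integral_mono) auto
  finally show ?thesis by (simp add: prob_space)
qed

lemma degen_bound:
  assumes \<beta>: "tuple \<beta>" and \<omega>: "\<omega> \<in> space P"
  shows "\<bar>degen \<beta> \<omega>\<bar> \<le> 2 * C * (real k + 1)"
proof -
  have "\<bar>\<Sum>u=1..k. marginal u (X (\<beta> u) \<omega>) - mean_f\<bar> \<le> (\<Sum>u=1..k. 2 * C)"
  proof (rule sum_abs[THEN order_trans, OF sum_mono])
    fix u assume u: "u \<in> {1..k}"
    show "\<bar>marginal u (X (\<beta> u) \<omega>) - mean_f\<bar> \<le> 2 * C"
      using marginal_X_bound[OF u tuple_ge_1[OF \<beta> u] \<omega>] mean_f_bound by linarith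
  qed
  then have "\<bar>\<Sum>u=1..k. marginal u (X (\<beta> u) \<omega>) - mean_f\<bar> \<le> 2 * C * k" by (simp add: mult_ac)
  then show ?thesis
    using kernel_sample_bound[OF assms] mean_f_bound
    unfolding degen_def by (simp add: algebra_simps)
qed

text \<open>\<open>V\<close> may contain the vertex \<open>\<beta> l\<close> but no other variable
  of the tuple. The kernel averages to \<open>marginal l (X (\<beta> l) \<omega>)\<close>, which
  cancels the projection term at position \<open>l\<close>; the other projection terms are centred
  and independent of \<open>G\<close>.\<close>

lemma expectation_degen_mult:
  assumes \<beta>: "tuple \<beta>" and l: "l \<in> {1..k}"
    and V: "V \<subseteq> all_vars" "V \<inter> tuple_vars ({1..k} - {l}) \<beta> = {}"
    and G: "G \<in> borel_measurable (vars_algebra V)" "\<And>\<omega>. \<omega> \<in> space P \<Longrightarrow> \<bar>G \<omega>\<bar> \<le> B"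
  shows "expectation (\<lambda>\<omega>. degen \<beta> \<omega> * G \<omega>) = 0"
proof -
  have GP: "G \<in> borel_measurable P"
    by (rule measurable_from_vars_algebra[OF G(1) V(1)])
  have iG: "integrable P G"
    by (rule integrable_bounded[OF GP G(2)])
  have imult: "integrable P (\<lambda>\<omega>. h \<omega> * G \<omega>)" if "h \<in> borel_measurable P" "\<And>\<omega>. \<omega> \<in> space P \<Longrightarrow> \<bar>h \<omega>\<bar> \<le> D" for h D
  proof (rule integrable_bounded[of _ "D * B"])
    fix \<omega> assume "\<omega> \<in> space P"
    then show "\<bar>h \<omega> * G \<omega>\<bar> \<le> D * B"
      unfolding abs_mult using that(2)[of \<omega>] G(2)[of \<omega>] by (intro mult_mono) auto
  qed (use that GP in measurable)
  have ik: "integrable P (\<lambda>\<omega>. f (sample {1..k} \<beta> \<omega>) * G \<omega>)"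
    by (rule imult[OF borel_measurable_integrable[OF integrable_kernel_sample[OF \<beta>]] kernel_sample_bound[OF \<beta>]])
  have im: "integrable P (\<lambda>\<omega>. marginal u (X (\<beta> u) \<omega>) * G \<omega>)" if "u \<in> {1..k}" for u
    using that tuple_ge_1[OF \<beta> that]
    by (intro imult[OF borel_measurable_integrable[OF integrable_marginal_X] marginal_X_bound])
  have "expectation (\<lambda>\<omega>. degen \<beta> \<omega> * G \<omega>) = expectation (\<lambda>\<omega>. f (sample {1..k} \<beta> \<omega>) * G \<omega>
      - mean_f * G \<omega> - (\<Sum>u=1..k. marginal u (X (\<beta> u) \<omega>) * G \<omega> - mean_f * G \<omega>))"
    by (simp only: degen_def left_diff_distrib sum_distrib_right)
  also have "\<dots> = expectation (\<lambda>\<omega>. f (sample {1..k} \<beta> \<omega>) * G \<omega>) - mean_f * expectation G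
      - (\<Sum>u=1..k. expectation (\<lambda>\<omega>. marginal u (X (\<beta> u) \<omega>) * G \<omega>) - mean_f * expectation G)"
  proof -
    have iu: "integrable P (\<lambda>\<omega>. marginal u (X (\<beta> u) \<omega>) * G \<omega> - mean_f * G \<omega>)" if "u \<in> {1..k}" for u
      using im[OF that] iG by simp
    have "expectation (\<lambda>\<omega>. \<Sum>u=1..k. marginal u (X (\<beta> u) \<omega>) * G \<omega> - mean_f * G \<omega>)
        = (\<Sum>u=1..k. expectation (\<lambda>\<omega>. marginal u (X (\<beta> u) \<omega>) * G \<omega> - mean_f * G \<omega>))"
      by (rule Bochner_Integration.integral_sum[OF iu])
    also have "\<dots> = (\<Sum>u=1..k. expectation (\<lambda>\<omega>. marginal u (X (\<beta> u) \<omega>) * G \<omega>) - mean_f * expectation G)"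
      using im iG by (intro sum.cong[OF refl]) simp
    finally have sum_eq: "expectation (\<lambda>\<omega>. \<Sum>u=1..k. marginal u (X (\<beta> u) \<omega>) * G \<omega> - mean_f * G \<omega>) = \<dots>" .
    have "integrable P (\<lambda>\<omega>. \<Sum>u=1..k. marginal u (X (\<beta> u) \<omega>) * G \<omega> - mean_f * G \<omega>)"
      by (rule Bochner_Integration.integrable_sum[OF iu])
    then show ?thesis
      using ik iG unfolding sum_eq[symmetric] by simp
  qed
  also have "expectation (\<lambda>\<omega>. f (sample {1..k} \<beta> \<omega>) * G \<omega>) = expectation (\<lambda>\<omega>. marginal l (X (\<beta> l) \<omega>) * G \<omega>)"
    by (rule expectation_kernel_mult[OF assms])
  also have "(\<Sum>u=1..k. expectation (\<lambda>\<omega>. marginal u (X (\<beta> u) \<omega>) * G \<omega>) - mean_f * expectation G)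
      = (\<Sum>u\<in>{l}. expectation (\<lambda>\<omega>. marginal u (X (\<beta> u) \<omega>) * G \<omega>) - mean_f * expectation G)"
  proof (rule sum.mono_neutral_right)
    show "\<forall>u\<in>{1..k} - {l}. expectation (\<lambda>\<omega>. marginal u (X (\<beta> u) \<omega>) * G \<omega>) - mean_f * expectation G = 0"
    proof
      fix u assume u: "u \<in> {1..k} - {l}"
      then have "Inl (\<beta> u) \<notin> V" using V(2) by (auto simp: tuple_vars_def)
      then show "expectation (\<lambda>\<omega>. marginal u (X (\<beta> u) \<omega>) * G \<omega>) - mean_f * expectation G = 0"
        using expectation_marginal_mult[OF _ _ V(1) _ G, of u "\<beta> u"] u tuple_ge_1[OF \<beta>, of u] by simp
    qed
  qed (use l in auto)
  finally show ?thesis by simp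
qed

section \<open>Products of degenerate terms and their moments\<close>

text \<open>An edge of \<open>\<beta>\<close> has two endpoints and only one of them can sit at
  position \<open>l\<close>, so a common edge would force a common index at another
  position.\<close>

lemma tuple_vars_disjoint:
  assumes "tuple \<beta>" "\<beta>' ` {1..k} \<inter> \<beta> ` ({1..k} - {l}) = {}"
  shows "tuple_vars {1..k} \<beta>' \<inter> tuple_vars ({1..k} - {l}) \<beta> = {}"
proof -
  have "edge \<beta>' p \<noteq> edge \<beta> q" if p: "p \<in> index_pairs k" and q: "q \<in> index_pairs k" for p q
  proof
    assume eq: "edge \<beta>' p = edge \<beta> q"
    have r: "fst p \<in> {1..k}" "snd p \<in> {1..k}" "fst q \<in> {1..k}" "snd q \<in> {1..k}" "fst q \<noteq> snd q"
      using p q by (auto simp: index_pairs_def)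
    have "\<beta> (fst q) \<in> {\<beta>' (fst p), \<beta>' (snd p)} \<and> \<beta> (snd q) \<in> {\<beta>' (fst p), \<beta>' (snd p)}"
      using eq by (auto simp: edge_def min_def max_def split: if_splits)
    then have "\<beta> (fst q) \<in> \<beta>' ` {1..k}" "\<beta> (snd q) \<in> \<beta>' ` {1..k}"
      using r by auto
    moreover have "fst q \<in> {1..k} - {l} \<or> snd q \<in> {1..k} - {l}" using r by auto
    ultimately show False using assms(2) by blast
  qed
  then have "edge \<beta>' ` index_pairs k \<inter> edge \<beta> ` index_pairs k = {}" by blast
  with assms(2) show ?thesis unfolding tuple_vars_def Plus_def by blast
qed

lemma expectation_prod_degen_eq_0:
  assumes J: "finite J" "j \<in> J" and B: "\<And>i. i \<in> J \<Longrightarrow> tuple (B i)" and l: "l \<in> {1..k}"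
    and disj: "\<And>i. i \<in> J - {j} \<Longrightarrow> B i ` {1..k} \<inter> B j ` ({1..k} - {l}) = {}"
  shows "expectation (\<lambda>\<omega>. \<Prod>i\<in>J. degen (B i) \<omega>) = 0"
proof -
  let ?V = "\<Union>i\<in>J - {j}. tuple_vars {1..k} (B i)"
  let ?G = "\<lambda>\<omega>. \<Prod>i\<in>J - {j}. degen (B i) \<omega>"
  let ?D = "2 * C * (real k + 1)"
  have "expectation (\<lambda>\<omega>. degen (B j) \<omega> * ?G \<omega>) = 0"
  proof (rule expectation_degen_mult[OF B[OF J(2)] l])
    show "?V \<subseteq> all_vars"
      using tuple_vars_subset B by blast
    show "?V \<inter> tuple_vars ({1..k} - {l}) (B j) = {}"
      using tuple_vars_disjoint[OF B[OF J(2)] disj] by blast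
    show "?G \<in> borel_measurable (vars_algebra ?V)"
      using B by (intro borel_measurable_prod measurable_degen) auto
    show "\<bar>?G \<omega>\<bar> \<le> (\<Prod>i\<in>J - {j}. ?D)" if "\<omega> \<in> space P" for \<omega>
      unfolding abs_prod using degen_bound[OF B that] by (intro prod_mono) auto
  qed
  then show ?thesis
    using J by (simp add: prod.remove)
qed

lemma distinct_tuples_tuple: "\<beta> \<in> distinct_tuples n k \<Longrightarrow> tuple \<beta>"
  by (auto simp: distinct_tuples_def tuple_def)

definition degen_part :: "nat \<Rightarrow> 'w \<Rightarrow> real" where
  "degen_part n \<omega> = (\<Sum>\<beta>\<in>distinct_tuples n k. degen \<beta> \<omega>)"

lemma measurable_degen_part [measurable]: "degen_part n \<in> borel_measurable P"
  unfolding degen_part_def[abs_def]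
  using measurable_degen_P distinct_tuples_tuple by (intro borel_measurable_sum) auto

text \<open>A product of kernels has mean zero as soon as one tuple shares at most one index with the
  others, so that only families of \<open>N\<close> tuples with at most \<open>N (k - 1)\<close> indices contribute.\<close>
lemma expectation_prod_degen_eq_0_of_many_indices:
  assumes J: "finite J" and B: "\<And>j. j \<in> J \<Longrightarrow> B j \<in> distinct_tuples n k"
    and many: "card J * (k - 1) < card (\<Union>j\<in>J. B j ` {1..k})"
  shows "expectation (\<lambda>\<omega>. \<Prod>j\<in>J. degen (B j) \<omega>) = 0"
proof -
  let ?R = "\<lambda>j. B j ` {1..k}"
  have inj: "inj_on (B j) {1..k}" if "j \<in> J" for j
    using B[OF that] by (simp add: distinct_tuples_def)
  have cR: "card (?R j) = k" if "j \<in> J" for j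
    using inj[OF that] by (simp add: card_image)
  \<comment> \<open>Otherwise each tuple would have at most \<open>k - 2\<close> private indices,
    and \<open>card_UNION_le_of_shared\<close> would contradict \<open>many\<close>.\<close>
  have "\<exists>j\<in>J. k - 2 < card (?R j - (\<Union>i\<in>J - {j}. ?R i))"
  proof (rule ccontr)
    assume "\<not> ?thesis"
    then have shared: "card (?R j - (\<Union>i\<in>J - {j}. ?R i)) \<le> k - 2" if "j \<in> J" for j
      using that by (meson not_le)
    have "card (\<Union>j\<in>J. ?R j) \<le> card J * (k - 1)"
      by (rule card_UNION_le_of_shared[OF J k _ _ shared]) (simp_all add: cR[simplified])
    with many show False by linarith
  qed
  then obtain j where j: "j \<in> J" "k - 2 < card (?R j - (\<Union>i\<in>J - {j}. ?R i))"
    by blast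
  let ?S = "?R j \<inter> (\<Union>i\<in>J - {j}. ?R i)"
  have "k = card ?S + card (?R j - (\<Union>i\<in>J - {j}. ?R i))"
    using card_Int_Diff[of "?R j"] cR[OF j(1)] by simp
  then have "card ?S \<le> Suc 0" using j(2) k by linarith
  moreover have "finite ?S" by (intro finite_Int disjI1 finite_imageI finite_atLeastAtMost)
  ultimately have S: "\<forall>x\<in>?S. \<forall>y\<in>?S. x = y"
    by (simp only: card_le_Suc0_iff_eq)
  obtain x where x: "?S \<subseteq> {x}"
  proof (cases "?S = {}")
    case False
    then obtain x where "x \<in> ?S" by blast
    with S have "?S \<subseteq> {x}" by blast
    then show ?thesis by (rule that)
  qed (use that in blast)
  \<comment> \<open>If nothing is shared, \<open>x\<close> is arbitrary and may lie outside the
    tuple; then any position serves, and 1 is taken.\<close>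
  obtain l where l: "l \<in> {1..k}" "x \<in> ?R j \<longrightarrow> x = B j l"
  proof (cases "x \<in> ?R j")
    case False
    have "1 \<in> {1..k}" using k by simp
    with False show ?thesis using that by blast
  qed (use that in blast)
  have disj: "B i ` {1..k} \<inter> B j ` ({1..k} - {l}) = {}" if i: "i \<in> J - {j}" for i
  proof (rule ccontr)
    assume "B i ` {1..k} \<inter> B j ` ({1..k} - {l}) \<noteq> {}"
    then obtain y where y: "y \<in> ?R i" "y \<in> B j ` ({1..k} - {l})"
      unfolding disjoint_iff by metis
    from y(2) obtain u where "y = B j u" "u \<in> {1..k} - {l}" by (rule imageE)
    with y(1) have u: "u \<in> {1..k}" "u \<noteq> l" "B j u \<in> ?R i" by simp_all
    then have "B j u \<in> ?S" using i by blast
    then have "B j u = x" "x \<in> ?R j" using x by blast+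
    then have "B j u = B j l" using l by simp
    then show False using inj[OF j(1)] u l(1) by (auto dest: inj_onD)
  qed
  show ?thesis
  proof (rule expectation_prod_degen_eq_0[OF J j(1) _ l(1)])
    show "tuple (B i)" if "i \<in> J" for i
      using B[OF that] by (rule distinct_tuples_tuple)
  qed (rule disj)
qed

text \<open>The power expands into a sum over families of \<open>N\<close> tuples, and only the
  surviving families are counted. The dependence on \<open>N\<close> is explicit because
  \<open>N\<close> will vary with \<open>n\<close>.\<close>

lemma moment_degen_part:
  assumes N: "0 < N"
  shows "expectation (\<lambda>\<omega>. degen_part n \<omega> ^ N)
    \<le> real n ^ (N * (k - 1)) * real (N * (k - 1)) ^ (N * k) * (2 * C * (real k + 1)) ^ N"
proof -
  let ?D = "2 * C * (real k + 1)"
  let ?\<B> = "{..<N} \<rightarrow>\<^sub>E distinct_tuples n k"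
  let ?v = "N * (k - 1)" and ?A = "{..<N} \<times> {1..k}"
  define good where "good = {B \<in> ?\<B>. card (\<Union>j<N. B j ` {1..k}) \<le> ?v}"
  have D: "0 \<le> ?D" using C_nonneg by simp
  have fin: "finite ?\<B>" by (intro finite_PiE finite_distinct_tuples) auto
  have Bt: "tuple (B j)" if "B \<in> ?\<B>" "j < N" for B j
    using that by (intro distinct_tuples_tuple[of _ n]) auto
  have prod_bound: "\<bar>\<Prod>j<N. degen (B j) \<omega>\<bar> \<le> ?D ^ N" if "B \<in> ?\<B>" "\<omega> \<in> space P" for B \<omega>
  proof -
    have "\<bar>\<Prod>j<N. degen (B j) \<omega>\<bar> \<le> (\<Prod>j<N. ?D)"
      unfolding abs_prod using degen_bound[OF Bt that(2)] that(1) by (intro prod_mono) auto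
    then show ?thesis by simp
  qed
  have int: "integrable P (\<lambda>\<omega>. \<Prod>j<N. degen (B j) \<omega>)" if "B \<in> ?\<B>" for B
    using prod_bound[OF that] Bt[OF that]
    by (intro integrable_bounded[of _ "?D ^ N"] borel_measurable_prod measurable_degen_P) auto
  have "degen_part n \<omega> ^ N = (\<Sum>B\<in>?\<B>. \<Prod>j<N. degen (B j) \<omega>)" for \<omega>
    using prod_sum_PiE[of "{..<N}" "\<lambda>_. distinct_tuples n k" "\<lambda>_ \<beta>. degen \<beta> \<omega>"] finite_distinct_tuples
    by (simp add: degen_part_def)
  then have "expectation (\<lambda>\<omega>. degen_part n \<omega> ^ N) = (\<Sum>B\<in>?\<B>. expectation (\<lambda>\<omega>. \<Prod>j<N. degen (B j) \<omega>))"
    using int by simp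
  also have "\<dots> = (\<Sum>B\<in>good. expectation (\<lambda>\<omega>. \<Prod>j<N. degen (B j) \<omega>))"
  proof (rule sum.mono_neutral_right[OF fin])
    show "\<forall>B\<in>?\<B> - good. expectation (\<lambda>\<omega>. \<Prod>j<N. degen (B j) \<omega>) = 0"
    proof
      fix B assume B: "B \<in> ?\<B> - good"
      then have "B \<in> ?\<B>" by (rule DiffD1)
      moreover from this B have "card {..<N} * (k - 1) < card (\<Union>j<N. B j ` {1..k})"
        unfolding good_def by (simp only: Diff_iff mem_Collect_eq not_le card_lessThan) simp
      ultimately show "expectation (\<lambda>\<omega>. \<Prod>j<N. degen (B j) \<omega>) = 0"
        by (intro expectation_prod_degen_eq_0_of_many_indices[where n = n] finite_lessThan)
          (erule PiE_mem, assumption+)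
    qed
  qed (auto simp: good_def)
  also have "\<dots> \<le> (\<Sum>B\<in>good. ?D ^ N)"
  proof (rule sum_mono)
    fix B assume "B \<in> good"
    then have B: "B \<in> ?\<B>" by (simp add: good_def)
    have "expectation (\<lambda>\<omega>. \<Prod>j<N. degen (B j) \<omega>) \<le> expectation (\<lambda>\<omega>. ?D ^ N)"
      using prod_bound[OF B] int[OF B] by (intro integral_mono) (auto simp: abs_le_iff)
    then show "expectation (\<lambda>\<omega>. \<Prod>j<N. degen (B j) \<omega>) \<le> ?D ^ N" by (simp add: prob_space)
  qed
  also have "\<dots> = real (card good) * ?D ^ N" by simp
  also have "\<dots> \<le> real (n ^ ?v * ?v ^ (N * k)) * ?D ^ N"
  proof (intro mult_right_mono of_nat_mono)
    \<comment> \<open>Uncurrying turns a family of \<open>N\<close> tuples into one map on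
      \<open>N * k\<close> points whose image is the set of indices used, so that
      \<open>card_small_image_functions_le\<close> applies.\<close>
    let ?U = "\<lambda>B. \<lambda>(j, u)\<in>?A. B j u"
    have goodD: "B j \<in> {1..k} \<rightarrow>\<^sub>E {1..n}" if "B \<in> good" "j \<in> {..<N}" for B j
    proof -
      have "B \<in> ?\<B>" using that(1) by (simp add: good_def)
      then have "B j \<in> distinct_tuples n k" using that(2) by (rule PiE_mem)
      then show ?thesis by (simp add: distinct_tuples_def)
    qed
    have "card good \<le> card {g \<in> ?A \<rightarrow>\<^sub>E {1..n}. card (g ` ?A) \<le> ?v}"
    proof (rule card_inj_on_le[of ?U])
      show "inj_on ?U good"
      proof (rule inj_onI)
        fix B B' assume B: "B \<in> good" "B' \<in> good" and eq: "?U B = ?U B'"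
        have "B j = B' j" if j: "j \<in> {..<N}" for j
        proof (rule extensionalityI[of _ "{1..k}"])
          show "B j \<in> extensional {1..k}" "B' j \<in> extensional {1..k}"
            using goodD[OF B(1) j] goodD[OF B(2) j] by (simp_all add: PiE_def)
          show "B j u = B' j u" if "u \<in> {1..k}" for u
            using fun_cong[OF eq, of "(j, u)"] that j by simp
        qed
        then show "B = B'"
          using B by (intro PiE_ext[of B "{..<N}" "\<lambda>_. distinct_tuples n k"]) (simp_all add: good_def)
      qed
      show "?U ` good \<subseteq> {g \<in> ?A \<rightarrow>\<^sub>E {1..n}. card (g ` ?A) \<le> ?v}"
      proof (rule image_subsetI)
        fix B assume B: "B \<in> good"
        have "?U B ` ?A = (\<Union>j<N. B j ` {1..k})"
          by (auto simp: image_iff)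
        moreover have "B j u \<in> {1..n}" if "j < N" "u \<in> {1..k}" for j u
          using PiE_mem[OF goodD[OF B] that(2)] that(1) by simp
        ultimately show "?U B \<in> {g \<in> ?A \<rightarrow>\<^sub>E {1..n}. card (g ` ?A) \<le> ?v}"
          using B by (simp add: good_def restrict_PiE_iff Pi_iff split_beta)
      qed
      show "finite {g \<in> ?A \<rightarrow>\<^sub>E {1..n}. card (g ` ?A) \<le> ?v}"
        by (rule finite_subset[of _ "?A \<rightarrow>\<^sub>E {1..n}"]) (auto intro: finite_PiE)
    qed
    also have "\<dots> \<le> card {1..n} ^ ?v * ?v ^ card ?A"
      using N k by (intro card_small_image_functions_le) auto
    finally show "card good \<le> n ^ ?v * ?v ^ (N * k)" by simp
  qed (use D in auto)
  finally show ?thesis by simp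
qed

section \<open>Variance and moderate deviations\<close>

definition proj :: "nat \<Rightarrow> 'w \<Rightarrow> real" where
  "proj i \<omega> = (\<Sum>l=1..k. marginal l (X i \<omega>) - mean_f)"

text \<open>By \<open>card_distinct_tuples_fiber\<close>, the number of tuples with a prescribed
  entry at a prescribed position; it grows like \<open>real n ^ (k - 1)\<close>.\<close>

definition coef :: "nat \<Rightarrow> real" where
  "coef n = real (card (distinct_tuples n k)) / real n"

abbreviation S :: "nat \<Rightarrow> 'w \<Rightarrow> real" where
  "S \<equiv> U_stat X Y k f"

lemma U_stat_decomposition:
  "S n \<omega> = real (card (distinct_tuples n k)) * mean_f + coef n * (\<Sum>i=1..n. proj i \<omega>) + degen_part n \<omega>"
proof -
  have "S n \<omega> = (\<Sum>\<beta>\<in>distinct_tuples n k. mean_f + (\<Sum>u=1..k. marginal u (X (\<beta> u) \<omega>) - mean_f) + degen \<beta> \<omega>)"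
    by (simp add: U_stat_def degen_def sample_def)
  also have "\<dots> = real (card (distinct_tuples n k)) * mean_f
      + (\<Sum>\<beta>\<in>distinct_tuples n k. \<Sum>u=1..k. marginal u (X (\<beta> u) \<omega>) - mean_f) + degen_part n \<omega>"
    by (simp add: sum.distrib degen_part_def)
  also have "(\<Sum>\<beta>\<in>distinct_tuples n k. \<Sum>u=1..k. marginal u (X (\<beta> u) \<omega>) - mean_f)
      = coef n * (\<Sum>i=1..n. proj i \<omega>)"
    unfolding coef_def proj_def by (rule sum_over_distinct_tuples)
  finally show ?thesis .
qed

lemma proj_compose: "proj i = (\<lambda>\<omega>. (\<lambda>x. \<Sum>l=1..k. marginal l x - mean_f) (X i \<omega>))"
  by (simp add: proj_def[abs_def])

lemma measurable_proj_kernel: "(\<lambda>x. \<Sum>l=1..k. marginal l x - mean_f) \<in> borel_measurable \<mu>"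
  using measurable_marginal by (intro borel_measurable_sum borel_measurable_diff borel_measurable_const)

lemma measurable_proj: "1 \<le> i \<Longrightarrow> proj i \<in> borel_measurable P"
  unfolding proj_compose by (rule measurable_compose[OF measurable_X measurable_proj_kernel])

lemma proj_bound:
  assumes "1 \<le> i" "\<omega> \<in> space P"
  shows "\<bar>proj i \<omega>\<bar> \<le> real k * (2 * C)"
proof -
  have "\<bar>proj i \<omega>\<bar> \<le> (\<Sum>l=1..k. 2 * C)"
    unfolding proj_def
  proof (rule sum_abs[THEN order_trans, OF sum_mono])
    fix l assume l: "l \<in> {1..k}"
    show "\<bar>marginal l (X i \<omega>) - mean_f\<bar> \<le> 2 * C"
      using marginal_X_bound[OF l assms] mean_f_bound by linarith
  qed
  then show ?thesis by simp
qed

lemma integrable_proj: "1 \<le> i \<Longrightarrow> integrable P (proj i)"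
  using proj_bound by (intro integrable_bounded[OF measurable_proj])

lemma expectation_proj:
  assumes "1 \<le> i"
  shows "expectation (proj i) = 0"
proof -
  have int: "integrable P (\<lambda>\<omega>. marginal l (X i \<omega>) - mean_f)" if "l \<in> {1..k}" for l
    using integrable_marginal_X[OF that assms] by simp
  have "expectation (proj i) = (\<Sum>l=1..k. expectation (\<lambda>\<omega>. marginal l (X i \<omega>) - mean_f))"
    unfolding proj_def[abs_def] by (rule Bochner_Integration.integral_sum[OF int])
  also have "\<dots> = 0"
    using integrable_marginal_X[OF _ assms] expectation_marginal_X[OF _ assms]
    by (intro sum.neutral ballI) (simp add: prob_space)
  finally show ?thesis .
qed

lemma indep_proj: "indep_vars (\<lambda>_. borel) proj {1..}"
  unfolding proj_compose[abs_def]
  by (rule indep_vars_compose2[OF X_indep]) (rule measurable_proj_kernel)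

definition proj_var :: real where
  "proj_var = expectation (\<lambda>\<omega>. (proj 1 \<omega>)\<^sup>2)"

lemma expectation_proj_sq:
  assumes "1 \<le> i"
  shows "expectation (\<lambda>\<omega>. (proj i \<omega>)\<^sup>2) = proj_var"
proof -
  have m: "(\<lambda>x. (\<Sum>l=1..k. marginal l x - mean_f)\<^sup>2) \<in> borel_measurable \<mu>"
    using measurable_proj_kernel by measurable
  show ?thesis
    using expectation_X[OF assms m] expectation_X[OF order_refl m]
    by (simp add: proj_var_def proj_def)
qed

text \<open>Turns the nondegeneracy assumption of the theorem into
  \<open>0 < proj_var\<close>.\<close>

lemma proj_var_eq: "proj_var = variance (\<lambda>\<omega>. \<Sum>l=1..k. marginal l (X 1 \<omega>))"
proof -
  have "expectation (\<lambda>\<omega>. \<Sum>l=1..k. marginal l (X 1 \<omega>)) = (\<Sum>l=1..k. expectation (\<lambda>\<omega>. marginal l (X 1 \<omega>)))"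
    using integrable_marginal_X by (intro Bochner_Integration.integral_sum) auto
  also have "\<dots> = (\<Sum>l=1..k. mean_f)"
    by (intro sum.cong[OF refl] expectation_marginal_X order_refl)
  finally have "expectation (\<lambda>\<omega>. \<Sum>l=1..k. marginal l (X 1 \<omega>)) = (\<Sum>l=1..k. mean_f)" .
  then show ?thesis
    by (simp only: proj_var_def proj_def sum_subtractf)
qed

lemma expectation_sum_proj_sq: "expectation (\<lambda>\<omega>. (\<Sum>i=1..n. proj i \<omega>)\<^sup>2) = real n * proj_var"
proof -
  have prod: "integrable P (\<lambda>\<omega>. proj i \<omega> * proj j \<omega>)"
    "expectation (\<lambda>\<omega>. proj i \<omega> * proj j \<omega>) = (if i = j then proj_var else 0)"
    if ij: "i \<in> {1..n}" "j \<in> {1..n}" for i j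
  proof -
    have i: "1 \<le> i" and j: "1 \<le> j" using ij by auto
    have "\<bar>proj i \<omega> * proj j \<omega>\<bar> \<le> (real k * (2 * C)) * (real k * (2 * C))" if "\<omega> \<in> space P" for \<omega>
      unfolding abs_mult using proj_bound[OF i that] proj_bound[OF j that] C_nonneg
      by (intro mult_mono) auto
    then show "integrable P (\<lambda>\<omega>. proj i \<omega> * proj j \<omega>)"
      using measurable_proj[OF i] measurable_proj[OF j] by (intro integrable_bounded) auto
    show "expectation (\<lambda>\<omega>. proj i \<omega> * proj j \<omega>) = (if i = j then proj_var else 0)"
    proof (cases "i = j")
      case True
      then show ?thesis
        using expectation_proj_sq[OF i] by (simp add: power2_eq_square)
    next
      case False
      have "indep_var borel (proj i) borel (proj j)"
      proof -
        have m: "proj i \<in> borel_measurable (vars_algebra {Inl i})" if "1 \<le> i" for i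
          unfolding proj_compose
          by (rule measurable_compose[OF measurable_vars_algebra_X measurable_proj_kernel]) (use that in auto)
        show ?thesis
          unfolding indep_var_distribution_eq
          using distr_pair_vars_algebra[OF _ _ _ m[OF i] m[OF j]] i j False measurable_proj[OF i] measurable_proj[OF j]
          by (simp add: InlI)
      qed
      then show ?thesis
        using integrable_proj[OF i] integrable_proj[OF j] False
        by (simp add: indep_var_lebesgue_integral expectation_proj[OF i])
    qed
  qed
  have "expectation (\<lambda>\<omega>. (\<Sum>i=1..n. proj i \<omega>)\<^sup>2) = expectation (\<lambda>\<omega>. \<Sum>i=1..n. \<Sum>j=1..n. proj i \<omega> * proj j \<omega>)"
    by (simp add: power2_eq_square sum_product)
  also have "\<dots> = (\<Sum>i=1..n. \<Sum>j=1..n. expectation (\<lambda>\<omega>. proj i \<omega> * proj j \<omega>))"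
    by (subst Bochner_Integration.integral_sum Bochner_Integration.integral_sum[OF prod(1)],
        intro Bochner_Integration.integrable_sum prod(1), assumption+)
       (intro sum.cong[OF refl] Bochner_Integration.integral_sum prod(1), assumption+)
  also have "\<dots> = (\<Sum>i=1..n. \<Sum>j=1..n. if i = j then proj_var else 0)"
    using prod(2) by (intro sum.cong[OF refl]) blast
  also have "\<dots> = real n * proj_var"
    by simp
  finally show ?thesis .
qed

lemma degen_part_bound: "\<exists>B. \<forall>\<omega>\<in>space P. \<bar>degen_part n \<omega>\<bar> \<le> B"
proof (intro exI ballI)
  fix \<omega> assume "\<omega> \<in> space P"
  then show "\<bar>degen_part n \<omega>\<bar> \<le> (\<Sum>\<beta>\<in>distinct_tuples n k. 2 * C * (real k + 1))"
    unfolding degen_part_def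
    by (intro sum_abs[THEN order_trans, OF sum_mono] degen_bound distinct_tuples_tuple)
qed

lemma integrable_degen_part_power: "integrable P (\<lambda>\<omega>. degen_part n \<omega> ^ N)"
proof -
  obtain B where B: "\<And>\<omega>. \<omega> \<in> space P \<Longrightarrow> \<bar>degen_part n \<omega>\<bar> \<le> B"
    using degen_part_bound by blast
  have "\<bar>degen_part n \<omega> ^ N\<bar> \<le> B ^ N" if "\<omega> \<in> space P" for \<omega>
    using power_mono[OF B[OF that], of N] by (simp add: power_abs)
  then show ?thesis by (intro integrable_bounded) auto
qed

lemma measurable_sum_proj [measurable]: "(\<lambda>\<omega>. \<Sum>i=1..n. proj i \<omega>) \<in> borel_measurable P"
  using measurable_proj by (intro borel_measurable_sum) auto

lemma sum_proj_bound: "\<omega> \<in> space P \<Longrightarrow> \<bar>\<Sum>i=1..n. proj i \<omega>\<bar> \<le> real n * (real k * (2 * C))"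
  using sum_mono[of "{1..n}" "\<lambda>i. \<bar>proj i \<omega>\<bar>" "\<lambda>_. real k * (2 * C)"] proj_bound[of _ \<omega>]
  by (intro order_trans[OF sum_abs]) simp

lemma integrable_sum_proj_power: "integrable P (\<lambda>\<omega>. (\<Sum>i=1..n. proj i \<omega>) ^ N)"
proof -
  have bd: "\<bar>(\<Sum>i=1..n. proj i \<omega>) ^ N\<bar> \<le> (real n * (real k * (2 * C))) ^ N" if "\<omega> \<in> space P" for \<omega>
    using power_mono[OF sum_proj_bound[OF that], of n N] by (simp add: power_abs)
  show ?thesis
    by (rule integrable_bounded[OF borel_measurable_power[OF measurable_sum_proj] bd])
qed

lemma measurable_U_stat [measurable]: "S n \<in> borel_measurable P"
  unfolding U_stat_decomposition[abs_def] by measurable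

lemma expectation_degen_part: "expectation (degen_part n) = 0"
proof -
  have int: "integrable P (degen \<beta>)" if "\<beta> \<in> distinct_tuples n k" for \<beta>
    using distinct_tuples_tuple[OF that] degen_bound by (intro integrable_bounded measurable_degen_P)
  have "expectation (degen \<beta>) = 0" if "\<beta> \<in> distinct_tuples n k" for \<beta>
    using expectation_degen_mult[OF distinct_tuples_tuple[OF that], of 1 "{}" "\<lambda>_. 1" 1] k by simp
  then show ?thesis
    unfolding degen_part_def[abs_def] using int by (simp add: Bochner_Integration.integral_sum)
qed

lemma U_stat_centered:
  "S n \<omega> - expectation (S n) = coef n * (\<Sum>i=1..n. proj i \<omega>) + degen_part n \<omega>"
proof -
  have "expectation (\<lambda>\<omega>. \<Sum>i=1..n. proj i \<omega>) = (\<Sum>i=1..n. expectation (proj i))"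
    using integrable_proj by (intro Bochner_Integration.integral_sum) auto
  also have "\<dots> = 0" using expectation_proj by (intro sum.neutral) auto
  finally have "expectation (\<lambda>\<omega>. \<Sum>i=1..n. proj i \<omega>) = 0" .
  moreover have "integrable P (\<lambda>\<omega>. coef n * (\<Sum>i=1..n. proj i \<omega>))"
    using integrable_sum_proj_power[of n 1] by simp
  moreover have "integrable P (degen_part n)"
    using integrable_degen_part_power[of n 1] by simp
  ultimately have "expectation (S n) = real (card (distinct_tuples n k)) * mean_f"
    unfolding U_stat_decomposition[abs_def] by (simp add: prob_space expectation_degen_part)
  then show ?thesis by (simp add: U_stat_decomposition)
qed

section \<open>Asymptotics of the variance\<close>

abbreviation V :: "nat \<Rightarrow> real" where
  "V n \<equiv> variance (S n)"

lemma coef_asymp: "(\<lambda>n. coef n / real n ^ (k - 1)) \<longlonglongrightarrow> 1"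
proof (rule Lim_transform_eventually[OF card_distinct_tuples_asymp])
  have "real n ^ k = real n * real n ^ (k - 1)" for n
    using k by (simp flip: power_Suc)
  then show "\<forall>\<^sub>F n in sequentially.
      real (card (distinct_tuples n k)) / real n ^ k = coef n / real n ^ (k - 1)"
    by (intro always_eventually allI) (simp add: coef_def)
qed

text \<open>The moment bound with \<open>N = 2\<close> gives the degenerate part a second moment of
  order \<open>n ^ (2 * (k - 1))\<close>, a factor \<open>1 / n\<close> below the variance of the
  linear part. The cross term is controlled by Young's inequality.\<close>

lemma variance_asymp:
  assumes v: "0 < proj_var"
  shows "(\<lambda>n. V n / ((coef n)\<^sup>2 * real n * proj_var)) \<longlonglongrightarrow> 1"
proof -
  let ?D = "2 * C * (real k + 1)"
  \<comment> \<open>The constant of \<open>moment_degen_part\<close> at \<open>N = 2\<close>,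
    divided by the variance of one projected term.\<close>
  define K where "K = real (2 * (k - 1)) ^ (2 * k) * ?D\<^sup>2 / proj_var"
  define q where "q n = coef n / real n ^ (k - 1)" for n
  have q: "q \<longlonglongrightarrow> 1" unfolding q_def[abs_def] by (rule coef_asymp)
  have err0: "(\<lambda>n. 1 / sqrt (real n) + (1 / real n + 1 / sqrt (real n)) * (K / (q n)\<^sup>2)) \<longlonglongrightarrow> 0"
  proof -
    have 1: "(\<lambda>n. 1 / sqrt (real n)) \<longlonglongrightarrow> 0"
      using tendsto_real_sqrt[OF lim_1_over_n] by (simp add: real_sqrt_divide)
    have 2: "(\<lambda>n. K / (q n)\<^sup>2) \<longlonglongrightarrow> K / 1\<^sup>2"
      by (intro tendsto_divide tendsto_power q) auto
    show ?thesis
      using tendsto_add[OF 1 tendsto_mult[OF tendsto_add[OF lim_1_over_n 1] 2]] by simp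
  qed
  have "\<forall>\<^sub>F n in sequentially. norm (V n / ((coef n)\<^sup>2 * real n * proj_var) - 1)
      \<le> 1 / sqrt (real n) + (1 / real n + 1 / sqrt (real n)) * (K / (q n)\<^sup>2)"
    using eventually_gt_at_top[of 0] order_tendstoD(1)[OF q zero_less_one]
  proof eventually_elim
    case (elim n)
    \<comment> \<open>Young's inequality leaves an error of order \<open>e + 1 / (e * n)\<close>,
      which this choice balances.\<close>
    define e where "e = 1 / sqrt (real n)"
    define T where "T = (coef n)\<^sup>2 * real n * proj_var"
    define H where "H = expectation (\<lambda>\<omega>. (degen_part n \<omega>)\<^sup>2)"
    let ?L = "\<lambda>\<omega>. coef n * (\<Sum>i=1..n. proj i \<omega>)"
    have e: "0 < e" using elim by (simp add: e_def)
    have cn: "coef n = q n * real n ^ (k - 1)" using elim by (simp add: q_def)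
    have T: "0 < T" using elim v by (simp add: T_def cn)
    have iL: "integrable P (\<lambda>\<omega>. (?L \<omega>)\<^sup>2)" "expectation (\<lambda>\<omega>. (?L \<omega>)\<^sup>2) = T"
      using integrable_sum_proj_power[of n 2]
      by (simp_all add: power_mult_distrib expectation_sum_proj_sq T_def del: One_nat_def)
    have iH: "integrable P (\<lambda>\<omega>. (degen_part n \<omega>)\<^sup>2)"
      by (rule integrable_degen_part_power)
    \<comment> \<open>Here \<open>(x + y)\<^sup>2 - x\<^sup>2 = 2 * x * y + y\<^sup>2\<close>, and
      the squares of \<open>e * x - y\<close> and \<open>e * x + y\<close> being nonnegative bounds
      \<open>2 * x * y\<close> from both sides.\<close>
    have young: "\<bar>(x + y)\<^sup>2 - x\<^sup>2\<bar> \<le> e * x\<^sup>2 + (1 + 1 / e) * y\<^sup>2" for x y :: real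
    proof -
      have "0 \<le> (e * x - y)\<^sup>2 / e" "0 \<le> (e * x + y)\<^sup>2 / e" using e by auto
      then have "2 * x * y \<le> e * x\<^sup>2 + y\<^sup>2 / e" "- (2 * x * y) \<le> e * x\<^sup>2 + y\<^sup>2 / e"
        using e by (simp_all add: power2_eq_square field_simps)
      then show ?thesis
        by (simp add: power2_sum algebra_simps abs_le_iff) (smt (verit) zero_le_power2)
    qed
    have iLH: "integrable P (\<lambda>\<omega>. (?L \<omega> + degen_part n \<omega>)\<^sup>2)"
    proof (rule Bochner_Integration.integrable_bound)
      show "integrable P (\<lambda>\<omega>. (1 + e) * (?L \<omega>)\<^sup>2 + (1 + 1 / e) * (degen_part n \<omega>)\<^sup>2)"
        by (rule Bochner_Integration.integrable_add[OF integrable_mult_right[OF iL(1)] integrable_mult_right[OF iH]])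
      show "AE \<omega> in P. norm ((?L \<omega> + degen_part n \<omega>)\<^sup>2)
          \<le> norm ((1 + e) * (?L \<omega>)\<^sup>2 + (1 + 1 / e) * (degen_part n \<omega>)\<^sup>2)"
      proof (rule AE_I2)
        fix \<omega>
        have "(?L \<omega> + degen_part n \<omega>)\<^sup>2 \<le> (1 + e) * (?L \<omega>)\<^sup>2 + (1 + 1 / e) * (degen_part n \<omega>)\<^sup>2"
          using young[of "?L \<omega>" "degen_part n \<omega>"] by (simp only: distrib_right mult_1_left abs_le_iff) linarith
        then show "norm ((?L \<omega> + degen_part n \<omega>)\<^sup>2)
            \<le> norm ((1 + e) * (?L \<omega>)\<^sup>2 + (1 + 1 / e) * (degen_part n \<omega>)\<^sup>2)"
          by (simp only: real_norm_def abs_of_nonneg zero_le_power2)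
      qed
    qed measurable
    define h b where "h = (\<lambda>\<omega>. (?L \<omega> + degen_part n \<omega>)\<^sup>2 - (?L \<omega>)\<^sup>2)"
      and "b = (\<lambda>\<omega>. e * (?L \<omega>)\<^sup>2 + (1 + 1 / e) * (degen_part n \<omega>)\<^sup>2)"
    have ih: "integrable P h" and ib: "integrable P b"
      unfolding h_def b_def using iLH iL(1) iH by simp_all
    have "V n - T = expectation h"
      unfolding h_def using iLH iL by (simp only: U_stat_centered Bochner_Integration.integral_diff)
    also have "\<bar>expectation h\<bar> \<le> expectation (\<lambda>\<omega>. \<bar>h \<omega>\<bar>)"
      by (rule integral_abs_bound)
    also have "\<dots> \<le> expectation b"
      by (rule integral_mono[OF integrable_abs[OF ih] ib]) (unfold h_def b_def, rule young)
    also have "\<dots> = e * T + (1 + 1 / e) * H"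
      unfolding b_def using iL iH by (simp add: H_def)
    finally have VT: "\<bar>V n - T\<bar> \<le> e * T + (1 + 1 / e) * H" .
    have HT: "H / T \<le> K / (q n)\<^sup>2 / real n"
    proof -
      have "H \<le> real n ^ (2 * (k - 1)) * real (2 * (k - 1)) ^ (2 * k) * ?D ^ 2"
        unfolding H_def by (rule moment_degen_part) simp
      also have "\<dots> = real n ^ (2 * (k - 1)) * (K * proj_var)"
        using v by (simp add: K_def)
      finally have "H / T \<le> real n ^ (2 * (k - 1)) * (K * proj_var) / T"
        using T by (intro divide_right_mono) auto
      moreover have "T = real n ^ (2 * (k - 1)) * ((q n)\<^sup>2 * real n * proj_var)"
        by (simp add: T_def cn power_mult_distrib power_even_eq)
      moreover have "real n ^ (2 * (k - 1)) \<noteq> 0" using elim by simp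
      ultimately show ?thesis
        using v elim(1) by simp
    qed
    have "norm (V n / T - 1) = \<bar>V n - T\<bar> / T"
      using T by (simp add: field_simps)
    also have "\<dots> \<le> (e * T + (1 + 1 / e) * H) / T"
      using VT T by (intro divide_right_mono) auto
    also have "\<dots> = e + (1 + 1 / e) * (H / T)"
      using T by (simp add: field_simps)
    also have "\<dots> \<le> e + (1 + 1 / e) * (K / (q n)\<^sup>2 / real n)"
      using HT e by (intro add_left_mono mult_left_mono) auto
    also have "\<dots> = e + (1 / real n + e) * (K / (q n)\<^sup>2)"
    proof -
      have "1 / e / real n = e"
        using elim by (simp add: e_def real_div_sqrt field_simps)
      then have "(1 + 1 / e) / real n = 1 / real n + e"
        by (simp add: add_divide_distrib)
      then show ?thesis by (metis times_divide_eq_left times_divide_eq_right mult.commute)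
    qed
    finally show ?case by (simp only: T_def e_def)
  qed
  then have "(\<lambda>n. V n / ((coef n)\<^sup>2 * real n * proj_var) - 1) \<longlonglongrightarrow> 0"
    by (rule Lim_null_comparison[OF _ err0])
  then show ?thesis by (simp add: LIM_zero_iff)
qed

lemma coef_nonneg: "0 \<le> coef n"
  by (simp add: coef_def)

lemma coef_over_sd_asymp:
  assumes v: "0 < proj_var"
  shows "(\<lambda>n. coef n * sqrt (real n) / sqrt (V n)) \<longlonglongrightarrow> 1 / sqrt proj_var"
proof (rule Lim_transform_eventually)
  have "(\<lambda>n. sqrt (inverse (V n / ((coef n)\<^sup>2 * real n * proj_var))) / sqrt proj_var) \<longlonglongrightarrow> sqrt (inverse 1) / sqrt proj_var"
    using v by (intro tendsto_divide tendsto_real_sqrt tendsto_inverse variance_asymp tendsto_const) auto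
  then show "(\<lambda>n. sqrt (inverse (V n / ((coef n)\<^sup>2 * real n * proj_var))) / sqrt proj_var) \<longlonglongrightarrow> 1 / sqrt proj_var"
    by simp
  show "\<forall>\<^sub>F n in sequentially. sqrt (inverse (V n / ((coef n)\<^sup>2 * real n * proj_var))) / sqrt proj_var
      = coef n * sqrt (real n) / sqrt (V n)"
    \<comment> \<open>The identity holds for every \<open>n\<close>: where a denominator vanishes,
      division by zero makes both sides 0.\<close>
    using v coef_nonneg by (intro always_eventually allI) (simp add: real_sqrt_divide real_sqrt_mult)
qed

text \<open>The order \<open>N\<close> of the moment is taken proportional to the speed.\<close>
lemma degen_part_negligible:
  assumes v: "0 < proj_var" and a: "filterlim a at_top sequentially"
    and growth: "(\<lambda>n. a n ^ (2 * k + 1) / sqrt (real n)) \<longlonglongrightarrow> 0"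
    and \<delta>: "0 < \<delta>"
  shows "\<forall>\<^sub>F n in sequentially.
    prob {\<omega> \<in> space P. \<delta> < \<bar>degen_part n \<omega> / (sqrt (V n) * a n)\<bar>} \<le> exp (- c * (a n)\<^sup>2)"
proof -
  \<comment> \<open>With \<open>1 \<le> c1\<close> and \<open>1 \<le> a n\<close>, rounding
    \<open>c1 * (a n)\<^sup>2\<close> up to an integer at most doubles it.\<close>
  define c1 where "c1 = max c 1"
  define D where "D = 2 * C * (real k + 1)"
  define q where "q n = coef n / real n ^ (k - 1)" for n
  define w where "w n = coef n * sqrt (real n) / sqrt (V n)" for n
  define b where "b n = a n ^ (2 * k + 1) / sqrt (real n)" for n
  \<comment> \<open>Collects what is independent of \<open>n\<close>; the 4 arises from
    \<open>N = 2 * p\<close> and \<open>p \<le> 2 * (c1 * (a n)\<^sup>2)\<close>.\<close>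
  define K where "K = D * (4 * c1 * real (k - 1)) ^ k / \<delta>"
  have c1: "1 \<le> c1" "c \<le> c1" by (simp_all add: c1_def)
  have D: "0 \<le> D" using C_nonneg by (simp add: D_def)
  have q: "q \<longlonglongrightarrow> 1" unfolding q_def[abs_def] by (rule coef_asymp)
  have "(\<lambda>n. K * (w n / q n) * b n) \<longlonglongrightarrow> K * (1 / sqrt proj_var / 1) * 0"
    using coef_over_sd_asymp[OF v] growth q
    unfolding w_def[abs_def, symmetric] b_def[abs_def, symmetric]
    by (intro tendsto_mult tendsto_divide tendsto_const) auto
  then have small: "\<forall>\<^sub>F n in sequentially. K * (w n / q n) * b n < exp (- 1)"
    by (rule order_tendstoD) simp
  have a1: "\<forall>\<^sub>F n in sequentially. 1 \<le> a n"
    using a by (simp add: filterlim_at_top)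
  have w0: "\<forall>\<^sub>F n in sequentially. 0 < w n"
    using order_tendstoD(1)[OF coef_over_sd_asymp[OF v], of 0] v by (simp add: w_def)
  show ?thesis
    using small a1 w0 order_tendstoD(1)[OF q zero_less_one] eventually_gt_at_top[of 0]
  proof eventually_elim
    case (elim n)
    define p where "p = nat \<lceil>c1 * (a n)\<^sup>2\<rceil>"
    define N where "N = 2 * p"
    define T where "T = \<delta> * (sqrt (V n) * a n)"
    \<comment> \<open>The root of order \<open>N\<close> of the Markov bound. It is enough that
      \<open>Q \<le> exp (- 1)\<close>, since then the bound is at most
      \<open>exp (- real N)\<close> and \<open>N\<close> exceeds
      \<open>c * (a n)\<^sup>2\<close>.\<close>
    define Q where "Q = real n ^ (k - 1) * real (N * (k - 1)) ^ k * D / T"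
    have a2: "1 \<le> (a n)\<^sup>2" using elim by simp
    then have ca: "1 \<le> c1 * (a n)\<^sup>2" using c1 mult_mono[of 1 c1 1 "(a n)\<^sup>2"] by simp
    have p: "c1 * (a n)\<^sup>2 \<le> real p" "real p \<le> 2 * (c1 * (a n)\<^sup>2)"
      using ca unfolding p_def by linarith+
    have p0: "0 < p" using p ca by linarith
    \<comment> \<open>A vanishing variance would give \<open>w n = 0\<close> by division by
      zero.\<close>
    have Vn: "0 < V n"
    proof (rule ccontr)
      assume "\<not> 0 < V n"
      moreover have "0 \<le> V n" by simp
      ultimately have "V n = 0" by linarith
      then show False using elim by (simp add: w_def)
    qed
    have T: "0 < T" using Vn \<delta> elim by (simp add: T_def)
    have Q0: "0 \<le> Q" using T D by (simp add: Q_def)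
    have int: "integrable P (\<lambda>\<omega>. degen_part n \<omega> ^ N)"
      by (rule integrable_degen_part_power)
    have "prob {\<omega> \<in> space P. \<delta> < \<bar>degen_part n \<omega> / (sqrt (V n) * a n)\<bar>}
        \<le> prob {\<omega> \<in> space P. T ^ N \<le> degen_part n \<omega> ^ N}"
    proof (rule finite_measure_mono)
      show "{\<omega> \<in> space P. \<delta> < \<bar>degen_part n \<omega> / (sqrt (V n) * a n)\<bar>} \<subseteq> {\<omega> \<in> space P. T ^ N \<le> degen_part n \<omega> ^ N}"
      proof (intro subsetI CollectI conjI)
        fix \<omega> assume "\<omega> \<in> {\<omega> \<in> space P. \<delta> < \<bar>degen_part n \<omega> / (sqrt (V n) * a n)\<bar>}"
        then have "\<omega> \<in> space P" and "\<delta> < \<bar>degen_part n \<omega>\<bar> / \<bar>sqrt (V n) * a n\<bar>"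
          by (simp_all only: mem_Collect_eq abs_divide)
        moreover have "0 < sqrt (V n) * a n" using Vn elim by simp
        ultimately have "T < \<bar>degen_part n \<omega>\<bar>"
          unfolding T_def by (simp only: abs_of_pos pos_less_divide_eq)
        then have "T ^ N \<le> \<bar>degen_part n \<omega>\<bar> ^ N"
          using T by (intro power_mono) auto
        then show "T ^ N \<le> degen_part n \<omega> ^ N"
          by (simp add: N_def power_even_abs)
        show "\<omega> \<in> space P" by fact
      qed
    qed measurable
    also have "\<dots> \<le> expectation (\<lambda>\<omega>. degen_part n \<omega> ^ N) / T ^ N"
      using T by (intro integral_Markov_inequality_measure[OF int, where A = "{}"]) (auto simp: N_def)
    also have "\<dots> \<le> (real n ^ (N * (k - 1)) * real (N * (k - 1)) ^ (N * k) * D ^ N) / T ^ N"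
      unfolding D_def using T p0 by (intro divide_right_mono moment_degen_part) (auto simp: N_def)
    also have "\<dots> = Q ^ N"
      by (simp add: Q_def power_divide power_mult_distrib power_mult[symmetric] mult.commute)
    also have "\<dots> \<le> exp (- 1) ^ N"
    proof (intro power_mono Q0)
      have "real (N * (k - 1)) \<le> 4 * c1 * real (k - 1) * (a n)\<^sup>2"
      proof -
        have "real (N * (k - 1)) = 2 * (real p * real (k - 1))"
          by (simp only: N_def of_nat_mult of_nat_numeral mult.assoc)
        also have "real p * real (k - 1) \<le> 2 * (c1 * (a n)\<^sup>2) * real (k - 1)"
          by (rule mult_right_mono[OF p(2)]) simp
        finally show ?thesis by (simp only: mult_ac) simp
      qed
      then have "real (N * (k - 1)) ^ k \<le> (4 * c1 * real (k - 1) * (a n)\<^sup>2) ^ k"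
        by (intro power_mono) auto
      then have "Q \<le> real n ^ (k - 1) * (4 * c1 * real (k - 1) * (a n)\<^sup>2) ^ k * D / T"
        unfolding Q_def using D T by (intro divide_right_mono mult_right_mono mult_left_mono) auto
      also have "\<dots> = K * (real n ^ (k - 1) / sqrt (V n)) * ((a n) ^ (2 * k) / a n)"
        by (simp add: K_def T_def power_mult_distrib mult_ac flip: power_mult)
      \<comment> \<open>The standard deviation is of order
        \<open>real n ^ (k - 1) * sqrt (real n)\<close>; this is the source of the decisive factor
        \<open>1 / sqrt (real n)\<close>.\<close>
      also have "real n ^ (k - 1) / sqrt (V n) = w n / q n / sqrt (real n)"
      proof -
        have "coef n \<noteq> 0" using elim by (auto simp: w_def)
        then show ?thesis using elim by (simp add: w_def q_def)
      qed
      \<comment> \<open>Since \<open>1 \<le> a n\<close>, dividing by \<open>a n\<close> may be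
        replaced by multiplying by it, which produces the power in the growth condition.\<close>
      also have "K * (w n / q n / sqrt (real n)) * (a n ^ (2 * k) / a n)
          \<le> K * (w n / q n / sqrt (real n)) * a n ^ (2 * k + 1)"
      proof (rule mult_left_mono)
        have "a n ^ (2 * k) / a n \<le> a n ^ (2 * k) * 1"
          using elim by (simp add: divide_le_eq mult_left_mono)
        also have "\<dots> \<le> a n ^ (2 * k) * a n" using elim by (intro mult_left_mono) auto
        finally show "a n ^ (2 * k) / a n \<le> a n ^ (2 * k + 1)" by (simp add: mult.commute)
        show "0 \<le> K * (w n / q n / sqrt (real n))"
          using elim \<delta> D c1 by (simp add: K_def)
      qed
      also have "\<dots> = K * (w n / q n) * b n"
        by (simp add: b_def)
      also have "\<dots> < exp (- 1)" by (fact elim(1))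
      finally show "Q \<le> exp (- 1)" by simp
    qed
    also have "\<dots> = exp (- real N)"
      by (simp flip: exp_of_nat_mult)
    also have "\<dots> \<le> exp (- c * (a n)\<^sup>2)"
    proof -
      have "c * (a n)\<^sup>2 \<le> c1 * (a n)\<^sup>2" using c1 by (intro mult_right_mono) auto
      then show ?thesis using p(1) by (simp add: N_def)
    qed
    finally show ?case .
  qed
qed

section \<open>Moderate deviations of the normalized statistic\<close>

theorem moderate_deviations:
  assumes v: "0 < proj_var" and a: "filterlim a at_top sequentially"
    and growth: "(\<lambda>n. a n ^ (2 * k + 1) / sqrt (real n)) \<longlonglongrightarrow> 0"
  shows "moderate_deviation_principle P
    (\<lambda>n \<omega>. normalized_U_stat P X Y k f n \<omega> / a n) (\<lambda>n. (a n)\<^sup>2) (\<lambda>x. ereal (x\<^sup>2 / 2))"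
proof -
  define c where "c n = coef n / (sqrt (V n) * a n)" for n
  have Z: "normalized_U_stat P X Y k f n \<omega> / a n
      = c n * (\<Sum>i=1..n. proj i \<omega>) + degen_part n \<omega> / (sqrt (V n) * a n)" for n \<omega>
    unfolding normalized_U_stat_def U_stat_centered[of n \<omega>] by (simp only: c_def add_divide_distrib) simp
  have a1: "\<forall>\<^sub>F n in sequentially. 1 \<le> a n"
    using a by (simp add: filterlim_at_top)
  \<comment> \<open>The tilt of a single summand vanishes: \<open>(a n)\<^sup>2 * c n\<close> is of
    order \<open>a n / sqrt (real n)\<close>, and \<open>a n\<close> is at most its own power of
    order \<open>2 * k + 1\<close>.\<close>
  have c1: "(\<lambda>n. (a n)\<^sup>2 * c n) \<longlonglongrightarrow> 0"
  proof (rule Lim_transform_eventually)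
    have "(\<lambda>n. a n / sqrt (real n)) \<longlonglongrightarrow> 0"
    proof (rule Lim_null_comparison[OF _ growth])
      show "\<forall>\<^sub>F n in sequentially. norm (a n / sqrt (real n)) \<le> a n ^ (2 * k + 1) / sqrt (real n)"
        using a1
      proof eventually_elim
        case (elim n)
        have "a n ^ 1 \<le> a n ^ (2 * k + 1)" using elim by (intro power_increasing) auto
        then show ?case using elim by (simp add: divide_right_mono)
      qed
    qed
    then show "(\<lambda>n. (coef n * sqrt (real n) / sqrt (V n)) * (a n / sqrt (real n))) \<longlonglongrightarrow> 0"
      using tendsto_mult[OF coef_over_sd_asymp[OF v]] by fastforce
    show "\<forall>\<^sub>F n in sequentially. (coef n * sqrt (real n) / sqrt (V n)) * (a n / sqrt (real n)) = (a n)\<^sup>2 * c n"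
      using a1 eventually_gt_at_top[of 0]
      by eventually_elim (simp add: c_def power2_eq_square)
  qed
  \<comment> \<open>The linear part has variance asymptotic to \<open>1 / (a n)\<^sup>2\<close>;
    this is where the normalization by the full variance is compared with the variance of the
    projection.\<close>
  have c2: "(\<lambda>n. real n * (a n)\<^sup>2 * (c n)\<^sup>2 * proj_var) \<longlonglongrightarrow> 1"
  proof (rule Lim_transform_eventually)
    show "(\<lambda>n. inverse (V n / ((coef n)\<^sup>2 * real n * proj_var))) \<longlonglongrightarrow> 1"
      using tendsto_inverse[OF variance_asymp[OF v]] by simp
    show "\<forall>\<^sub>F n in sequentially. inverse (V n / ((coef n)\<^sup>2 * real n * proj_var)) = real n * (a n)\<^sup>2 * (c n)\<^sup>2 * proj_var"
      using a1 by eventually_elim (simp add: c_def power_divide power_mult_distrib)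
  qed
  have s: "filterlim (\<lambda>n. (a n)\<^sup>2) at_top sequentially"
    by (rule filterlim_pow_at_top[OF _ a]) simp
  show ?thesis
  proof (rule moderate_deviation_principle_of_log_mgf[OF s])
    show "(\<lambda>\<omega>. normalized_U_stat P X Y k f n \<omega> / a n) \<in> borel_measurable P" for n
      unfolding normalized_U_stat_def by measurable
    show "integrable P (\<lambda>\<omega>. exp (t * (c n * (\<Sum>i=1..n. proj i \<omega>))))" for n t
    proof (rule integrable_bounded)
      show "\<bar>exp (t * (c n * (\<Sum>i=1..n. proj i \<omega>)))\<bar> \<le> exp (\<bar>t * c n\<bar> * (real n * (real k * (2 * C))))"
        if "\<omega> \<in> space P" for \<omega>
      proof -
        have "t * (c n * (\<Sum>i=1..n. proj i \<omega>)) \<le> \<bar>t * c n\<bar> * \<bar>\<Sum>i=1..n. proj i \<omega>\<bar>"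
          by (metis abs_ge_self abs_mult mult.assoc)
        also have "\<dots> \<le> \<bar>t * c n\<bar> * (real n * (real k * (2 * C)))"
          by (intro mult_left_mono sum_proj_bound that) simp
        finally show ?thesis by simp
      qed
    qed measurable
    show "(\<lambda>n. ln (expectation (\<lambda>\<omega>. exp (t * (a n)\<^sup>2 * (c n * (\<Sum>i=1..n. proj i \<omega>))))) / (a n)\<^sup>2) \<longlonglongrightarrow> t\<^sup>2 / 2" for t
    proof (rule log_mgf_weighted_sum_tendsto[OF indep_proj proj_bound expectation_proj expectation_proj_sq v _ c1 c2])
      show "\<forall>\<^sub>F n in sequentially. 0 < (a n)\<^sup>2"
        using a1 by eventually_elim simp
    qed
    fix \<delta> C' :: real assume "0 < \<delta>"
    from degen_part_negligible[OF v a growth this, of C']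
    show "\<forall>\<^sub>F n in sequentially. prob {\<omega> \<in> space P.
        \<delta> < \<bar>normalized_U_stat P X Y k f n \<omega> / a n - c n * (\<Sum>i=1..n. proj i \<omega>)\<bar>} \<le> exp (- C' * (a n)\<^sup>2)"
      by (simp add: Z)
  qed
qed

end

text \<open>The exponents match: \<open>(2 * k + 1) / (2 + 4 * k) = 1 / 2\<close>.\<close>

lemma power_div_sqrt_tendsto_0_of_much_less:
  fixes a :: "nat \<Rightarrow> real" and k :: nat
  assumes "much_less a (\<lambda>n. real n powr (1 / (2 + 4 * real k)))"
  shows "(\<lambda>n. a n ^ (2 * k + 1) / sqrt (real n)) \<longlonglongrightarrow> 0"
proof (rule Lim_transform_eventually)
  let ?e = "1 / (2 + 4 * real k)"
  have "(\<lambda>n. a n / real n powr ?e) \<longlonglongrightarrow> 0"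
    using assms by (simp add: much_less_def)
  from tendsto_power[OF this, of "2 * k + 1"]
  show "(\<lambda>n. (a n / real n powr ?e) ^ (2 * k + 1)) \<longlonglongrightarrow> 0" by simp
  show "\<forall>\<^sub>F n in sequentially. (a n / real n powr ?e) ^ (2 * k + 1) = a n ^ (2 * k + 1) / sqrt (real n)"
    using eventually_gt_at_top[of 0]
  proof eventually_elim
    case (elim n)
    have e: "?e * real (2 * k + 1) = 1 / 2" by (simp add: field_simps)
    have "(real n powr ?e) ^ (2 * k + 1) = (real n powr ?e) powr real (2 * k + 1)"
      using elim by (intro powr_realpow[symmetric]) simp
    also have "\<dots> = sqrt (real n)"
      by (simp only: powr_powr e) (simp add: powr_half_sqrt)
    finally have "(real n powr ?e) ^ (2 * k + 1) = sqrt (real n)" .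
    then show ?case by (simp only: power_divide)
  qed
qed

theorem corollary4p4:
  fixes P :: "'w measure" and \<mu> :: "'s measure" and \<QQ> :: "'m measure"
    and X :: "nat \<Rightarrow> 'w \<Rightarrow> 's" and Y :: "nat \<Rightarrow> nat \<Rightarrow> 'w \<Rightarrow> 'm"
    and k :: nat
    and f :: "(nat \<Rightarrow> 's) \<times> (nat \<times> nat \<Rightarrow> 'm) \<Rightarrow> real"
    and a :: "nat \<Rightarrow> real"
  assumes "generalized_U_statistic P \<mu> \<QQ> X Y"
    and "k \<ge> 2"
    and "f \<in> borel_measurable (kernel_space \<mu> \<QQ> k)"
    and "bounded (f ` space (kernel_space \<mu> \<QQ> k))"
    and "prob_space.variance P (\<lambda>\<omega>. \<Sum>l=1..k. kernel_marginal \<mu> \<QQ> k f l (X 1 \<omega>)) > 0"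
    and "filterlim a at_top sequentially"
    and "much_less a (\<lambda>n. real n powr (1 / (2 + 4 * real k)))"
  shows "moderate_deviation_principle P
           (\<lambda>n \<omega>. normalized_U_stat P X Y k f n \<omega> / a n)
           (\<lambda>n. (a n)\<^sup>2)
           (\<lambda>x. ereal (x\<^sup>2 / 2))"
proof -
  obtain C where C: "\<And>z. z \<in> space (kernel_space \<mu> \<QQ> k) \<Longrightarrow> \<bar>f z\<bar> \<le> C"
    using assms(4) by (auto simp: bounded_iff)
  interpret bounded_kernel P \<mu> \<QQ> X Y k f C
    using assms(1-3) C by (intro bounded_kernel.intro bounded_kernel_axioms.intro)
  show ?thesis
    using assms(5-7) by (intro moderate_deviations power_div_sqrt_tendsto_0_of_much_less) (simp_all only: proj_var_eq)
qed

end
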